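(* Let $a>0$, $\tau_0\in\mathbb{R}$, $f_0\in\mathbb{R}$ with $f_0>0$, and let $(\tau,f)$ be the solution of the system of ordinary differential equations $$\lambda\frac{d\tau}{dt}=-f\tau+Ga,\qquad \frac{df}{dt}=(-1+\xi|\tau|)f^2-\nu f^3,\qquad (\tau,f)(0)=(\tau_0,f_0).$$ Then the solution $(\tau,f)$ remains bounded. In addition, let $$(\tau_\infty,f_\infty)=\left(\frac{\sqrt{1+4\nu\xi Ga}+1}{2\xi},\ \frac{\sqrt{1+4\nu\xi Ga}-1}{2\nu}\right),\qquad \sigma=\min\left\{\frac{3Ga}{Ga\nu+4\tau_\infty},\ \frac{\sqrt{1+4\nu\xi Ga}-1}{3\nu}\right\},$$ and assume that $$-\frac1\lambda-2+2\xi(1+Ga)\left(\frac1\sigma+\frac{\lambda\xi}{2Ga}\left(\frac{\nu\sigma+1}{\xi}+\frac4\xi\right)^2\right)<0.$$ Then $(\tau,f)$ converges to $(\tau_\infty,f_\infty)$ in the long time and the rate of convergence is exponential: for $t$ sufficiently large, $$|\tau(t)-\tau_\infty|+|f(t)-f_\infty|\le C_0e^{-C_rt},$$ where $C_0$ is a constant independent of time and $$C_r=\begin{cases}\frac12\left(\frac{f_\infty}{\lambda}+\nu f_\infty^2\right)-\frac12\sqrt{\Delta}, & \text{if }\Delta\ge0,\\[2mm] \frac12\left(\frac{f_\infty}{\lambda}+\nu f_\infty^2\right), & \text{if }\Delta<0,\end{cases}$$ with $$\Delta=f_\infty^2\left(\left(\frac1\lambda+\nu f_\infty\right)^2-4\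left(\frac{\nu}{\lambda}f_\infty+\frac{\xi}{\lambda}\tau_\infty\right)\right).$$
   Context: $\lambda,G,\xi,\nu$ are positive constants; $\tau,f$ are real-valued functions of time $t\ge0$. $(\tau_\infty,f_\infty)$ is the unique steady state of the system with $f_\infty>0$.
   Formalization: For Δ = 0 the stated bound C_0 e^{-C_r t} is false in general (the linearisation at the steady state is a Jordan block, giving solutions of order t e^{-C_r t}); in that case the formal bound is C_0 (1+t) e^{-C_r t} with the same C_r. *)

theory Defs
  imports "HOL-Analysis.Analysis"
begin

text \<open>A solution is global in forward time; at \<open>t = 0\<close> the derivatives are one-sided.\<close>

definition ode_solution ::
  "real \<Rightarrow> real \<Rightarrow> real \<Rightarrow> real \<Rightarrow> real \<Rightarrow> real \<Rightarrow> real \<Rightarrow> (real \<Rightarrow> real) \<Rightarrow> (real \<Rightarrow> real) \<Rightarrow> bool"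
  where
  "ode_solution lam G \<xi> \<nu> a \<tau>0 f0 \<tau> f \<longleftrightarrow>
     (\<forall>t\<ge>0. \<exists>\<tau>' f'.
        (\<tau> has_real_derivative \<tau>') (at t within {0..}) \<and>
        (f has_real_derivative f') (at t within {0..}) \<and>
        lam * \<tau>' = - f t * \<tau> t + G * a \<and>
        f' = (-1 + \<xi> * \<bar>\<tau> t\<bar>) * (f t)^2 - \<nu> * (f t)^3) \<and>
     \<tau> 0 = \<tau>0 \<and> f 0 = f0"

definition tau_inf :: "real \<Rightarrow> real \<Rightarrow> real \<Rightarrow> real \<Rightarrow> real" where
  "tau_inf G \<xi> \<nu> a = (sqrt (1 + 4 * \<nu> * \<xi> * G * a) + 1) / (2 * \<xi>)"

definition f_inf :: "real \<Rightarrow> real \<Rightarrow> real \<Rightarrow> real \<Rightarrow> real" where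
  "f_inf G \<xi> \<nu> a = (sqrt (1 + 4 * \<nu> * \<xi> * G * a) - 1) / (2 * \<nu>)"

definition sigma :: "real \<Rightarrow> real \<Rightarrow> real \<Rightarrow> real \<Rightarrow> real" where
  "sigma G \<xi> \<nu> a =
     min (3 * G * a / (G * a * \<nu> + 4 * tau_inf G \<xi> \<nu> a))
         ((sqrt (1 + 4 * \<nu> * \<xi> * G * a) - 1) / (3 * \<nu>))"

definition Delta :: "real \<Rightarrow> real \<Rightarrow> real \<Rightarrow> real \<Rightarrow> real \<Rightarrow> real" where
  "Delta lam G \<xi> \<nu> a =
     (f_inf G \<xi> \<nu> a)^2 *
       ((1 / lam + \<nu> * f_inf G \<xi> \<nu> a)^2
        - 4 * (\<nu> / lam * f_inf G \<xi> \<nu> a + \<xi> / lam * tau_inf G \<xi> \<nu> a))"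

definition conv_rate :: "real \<Rightarrow> real \<Rightarrow> real \<Rightarrow> real \<Rightarrow> real \<Rightarrow> real" where
  "conv_rate lam G \<xi> \<nu> a =
     (if Delta lam G \<xi> \<nu> a \<ge> 0
      then 1/2 * (f_inf G \<xi> \<nu> a / lam + \<nu> * (f_inf G \<xi> \<nu> a)^2)
           - 1/2 * sqrt (Delta lam G \<xi> \<nu> a)
      else 1/2 * (f_inf G \<xi> \<nu> a / lam + \<nu> * (f_inf G \<xi> \<nu> a)^2))"

text \<open>When \<open>\<Delta> = 0\<close>, \<open>- conv_rate\<close> is a double, non-diagonalisable eigenvalue of the
  linearisation at the steady state, and there are solutions whose distance to the steady state
  is of exact order \<open>t * exp (- conv_rate * t)\<close> (for instance starting near the steady state for
  \<open>\<xi> = G = 1\<close>, \<open>a = 10\<close>, \<open>\<nu> = 324/1681\<close>, \<open>lam = 41/400\<close>). So \<open>C * exp (- conv_rate * t)\<close>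
  bounds that distance only when \<open>\<Delta> \<noteq> 0\<close>; for \<open>\<Delta> = 0\<close> a factor \<open>1 + t\<close> is needed.\<close>

end

theory Submission
  imports Defs
begin

text \<open>
  Once \<open>f > 0\<close> and \<open>\<tau> > 0\<close>, which holds from some time on, the system is a damped nonlinear
  oscillator in disguise. Put \<open>w = \<xi> * \<tau> - 1 - \<nu> * f\<close>, so that \<open>f' = f^2 * w\<close>, and pass to
  the time \<open>s\<close> with \<open>ds = f dt\<close> and to \<open>u = ln f\<close>. Then \<open>du/ds = w\<close>, and with
  \<open>\<kappa> = 1 / lam\<close> and \<open>\<beta> = \<xi> * G * a\<close> one has
  \<open>dw/ds = - (\<kappa> + \<nu> * exp u) * w - \<kappa> * (1 + \<nu> * exp u - \<beta> * exp (- u))\<close>. The damping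
  coefficient is positive and the restoring force is increasing in \<open>u\<close>, with its only zero at
  the steady state. Kinetic plus potential energy,
  \<open>w^2 / 2 + \<kappa> * (ln f + \<nu> * f + \<beta> / f)\<close>, is therefore nonincreasing. The potential blows up
  both as \<open>f \<rightarrow> 0\<close> and as \<open>f \<rightarrow> \<infinity>\<close>, so an energy bound keeps \<open>f\<close> away from \<open>0\<close> and
  bounds \<open>f\<close> and \<open>w\<close>, hence \<open>\<tau>\<close>; this is \<open>orbit_bounds\<close>.

  The energy alone dissipates only through \<open>w\<close>. Adding a small multiple of velocity times
  restoring force makes the displacement dissipate as well, and along the bounded orbit the
  corrected energy is comparable to the squared distance to the steady state. Hence the orbit
  converges exponentially, at some unspecified rate; this is \<open>exponential_decay\<close>.

  The rate is then sharpened at the steady state. The orbit solves the linearised equation up to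
  a quadratic error, which by the crude decay is a perturbation with an exponentially decaying,
  hence integrable, coefficient. A quadratic form that decays at exactly the spectral rate under
  the linear flow keeps that rate under such a perturbation, by Gronwall's inequality. The form
  exists when the two eigenvalues differ, that is for nonzero discriminant
  (\<open>decay_rate_nondegenerate\<close>); for a double eigenvalue its coefficients have to grow with
  time, which costs the factor \<open>1 + t\<close> (\<open>decay_rate_degenerate\<close>).
\<close>

section \<open>Sharp decay rates for perturbed planar linear systems\<close>

text \<open>
  The coefficient \<open>K * exp (- \<eta> * t)\<close> has finite integral over the half line, so it costs only a
  constant factor and leaves the rate \<open>\<rho>\<close> unchanged: its antiderivative goes into the integrating
  factor, which stays bounded.
\<close>
lemma gronwall_integrable_perturbation:
  fixes Q Q' :: "real \<Rightarrow> real"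
  assumes "\<eta> > 0" and "K \<ge> 0"
    and nonneg: "\<And>t. t \<ge> T \<Longrightarrow> Q t \<ge> 0"
    and deriv: "\<And>t. t \<ge> T \<Longrightarrow> (Q has_real_derivative Q' t) (at t)"
    and ineq: "\<And>t. t \<ge> T \<Longrightarrow> Q' t \<le> (- \<rho> + K * exp (- \<eta> * t)) * Q t"
  shows "\<exists>C\<ge>0. \<forall>t\<ge>T. Q t \<le> C * exp (- \<rho> * t)"
proof -
  define S where "S = (\<lambda>t. Q t * exp (\<rho> * t + K / \<eta> * exp (- \<eta> * t)))"
  define S' where "S' = (\<lambda>t. (Q' t + (\<rho> - K * exp (- \<eta> * t)) * Q t)
                                * exp (\<rho> * t + K / \<eta> * exp (- \<eta> * t)))"
  have dS: "(S has_real_derivative S' t) (at t)" if "t \<ge> T" for t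
    unfolding S_def S'_def using \<open>\<eta> > 0\<close>
    by (auto intro!: derivative_eq_intros deriv[OF that] simp: field_simps)
  have "S' t \<le> 0" if "t \<ge> T" for t
    unfolding S'_def using ineq[OF that]
    by (intro mult_nonpos_nonneg) (auto simp: algebra_simps)
  then have mono: "S t \<le> S T" if "t \<ge> T" for t
    using DERIV_nonpos_imp_nonincreasing[OF that, of S] dS by (meson order.trans)
  have "S T \<ge> 0"
    unfolding S_def using nonneg by simp
  moreover have "Q t \<le> S T * exp (- \<rho> * t)" if "t \<ge> T" for t
  proof -
    have "Q t * 1 \<le> Q t * exp (K / \<eta> * exp (- \<eta> * t))"
      using nonneg[OF that] assms(1,2) by (intro mult_left_mono) auto
    also have "\<dots> = S t * exp (- \<rho> * t)"
      unfolding S_def by (simp add: exp_add exp_minus)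
    also have "\<dots> \<le> S T * exp (- \<rho> * t)"
      using mono[OF that] by simp
    finally show ?thesis by simp
  qed
  ultimately show ?thesis by blast
qed

lemma mult_le_abs_mult_bound:
  fixes y n B :: real
  assumes "\<bar>n\<bar> \<le> B"
  shows "y * n \<le> \<bar>y\<bar> * B"
proof -
  have "y * n \<le> \<bar>y\<bar> * \<bar>n\<bar>"
    by (simp flip: abs_mult)
  also have "\<dots> \<le> \<bar>y\<bar> * B"
    using assms by (intro mult_left_mono) auto
  finally show ?thesis .
qed

lemma sum_bound_of_square_bound:
  fixes x v q :: real
  assumes "(\<bar>x\<bar> + \<bar>v\<bar>)^2 \<le> c * q" and "c \<ge> 0" and "C \<ge> 0" and "q \<le> C * exp (- (2 * r) * t)"
  shows "\<bar>x\<bar> + \<bar>v\<bar> \<le> sqrt (c * C) * exp (- r * t)"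
proof (rule power2_le_imp_le)
  have "exp (- (2 * r) * t) = (exp (- r * t))^2"
    by (simp add: power2_eq_square flip: exp_add)
  moreover have "c * q \<le> c * (C * exp (- (2 * r) * t))"
    using assms by (intro mult_left_mono)
  ultimately show "(\<bar>x\<bar> + \<bar>v\<bar>)^2 \<le> (sqrt (c * C) * exp (- r * t))^2"
    using assms by (simp add: power_mult_distrib)
qed (use assms in auto)

text \<open>
  The linear part has eigenvalues \<open>- k \<plusminus> sqrt D\<close>. Under the linear flow the derivative of
  \<open>v^2 + \<bar>D\<bar> * x^2\<close> is \<open>- 2 * k\<close> times the form itself plus the cross term
  \<open>2 * (D + \<bar>D\<bar>) * x * v\<close>. That term vanishes for \<open>D < 0\<close> (a spiral), and for \<open>D > 0\<close> (a
  node) it is at most \<open>2 * sqrt D\<close> times the form, by the arithmetic-geometric mean inequality.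
  So the form decays at twice the spectral rate. It is definite exactly because \<open>D \<noteq> 0\<close>.
\<close>
lemma decay_rate_nondegenerate:
  fixes x v n1 n2 :: "real \<Rightarrow> real"
  assumes "\<eta> > 0" and "K \<ge> 0" and "D \<noteq> 0"
    and dx: "\<And>t. t \<ge> T \<Longrightarrow> (x has_real_derivative - k * x t + v t + n1 t) (at t)"
    and dv: "\<And>t. t \<ge> T \<Longrightarrow> (v has_real_derivative - k * v t + D * x t + n2 t) (at t)"
    and n1: "\<And>t. t \<ge> T \<Longrightarrow> \<bar>n1 t\<bar> \<le> K * exp (- \<eta> * t) * (\<bar>x t\<bar> + \<bar>v t\<bar>)"
    and n2: "\<And>t. t \<ge> T \<Longrightarrow> \<bar>n2 t\<bar> \<le> K * exp (- \<eta> * t) * (\<bar>x t\<bar> + \<bar>v t\<bar>)"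
  shows "\<exists>C. \<forall>t\<ge>T. \<bar>x t\<bar> + \<bar>v t\<bar> \<le> C * exp (- (k - sqrt (max D 0)) * t)"
proof -
  define s where "s = sqrt (max D 0)"
  define Q where "Q = (\<lambda>t. (v t)^2 + \<bar>D\<bar> * (x t)^2)"
  define Q' where "Q' = (\<lambda>t. 2 * v t * (- k * v t + D * x t + n2 t)
                              + 2 * \<bar>D\<bar> * x t * (- k * x t + v t + n1 t))"
  define c where "c = 2 * (1 + 1 / \<bar>D\<bar>)"
  have norm: "(\<bar>x t\<bar> + \<bar>v t\<bar>)^2 \<le> c * Q t" for t
  proof -
    have "(\<bar>x t\<bar> + \<bar>v t\<bar>)^2 \<le> 2 * ((x t)^2 + (v t)^2)"
      using sum_squares_bound[of "\<bar>x t\<bar>" "\<bar>v t\<bar>"] by (simp add: power2_sum)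
    also have "\<dots> \<le> 2 * ((x t)^2 + (v t)^2) + 2 * (\<bar>D\<bar> * (x t)^2 + 1 / \<bar>D\<bar> * (v t)^2)"
      by simp
    also have "\<dots> = c * Q t"
      unfolding c_def Q_def using \<open>D \<noteq> 0\<close> by (simp add: algebra_simps)
    finally show ?thesis .
  qed
  have dQ: "(Q has_real_derivative Q' t) (at t)" if "t \<ge> T" for t
    unfolding Q_def Q'_def
    by (auto intro!: derivative_eq_intros dx[OF that] dv[OF that] simp: algebra_simps)
  have cross: "2 * (D + \<bar>D\<bar>) * (x t * v t) \<le> 2 * s * Q t" for t
  proof (cases "D > 0")
    case True
    then have s: "s^2 = D" "\<bar>D\<bar> = D" "s \<ge> 0" unfolding s_def by auto
    then have "0 \<le> 2 * s * (v t - s * x t)^2"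
      by simp
    also have "\<dots> = 2 * s * ((v t)^2 + s^2 * (x t)^2) - 2 * (s^2 + s^2) * (x t * v t)"
      by (simp add: algebra_simps power2_eq_square)
    finally show ?thesis
      unfolding Q_def s by simp
  next
    case False
    then have "s = 0" "\<bar>D\<bar> = - D" unfolding s_def by (auto simp: max_def)
    then show ?thesis by simp
  qed
  have "Q' t \<le> (- (2 * (k - s)) + 2 * (1 + \<bar>D\<bar>) * K * c * exp (- \<eta> * t)) * Q t"
    if "t \<ge> T" for t
  proof -
    define B where "B = K * exp (- \<eta> * t) * (\<bar>x t\<bar> + \<bar>v t\<bar>)"
    have "v t * n2 t \<le> \<bar>v t\<bar> * B"
      using n2[OF that] unfolding B_def
      by (rule mult_le_abs_mult_bound)
    moreover have "x t * n1 t \<le> \<bar>x t\<bar> * B"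
      using n1[OF that] unfolding B_def
      by (rule mult_le_abs_mult_bound)
    then have "\<bar>D\<bar> * (x t * n1 t) \<le> \<bar>D\<bar> * (\<bar>x t\<bar> * B)"
      by (simp add: mult_left_mono)
    moreover have "B \<ge> 0" unfolding B_def using \<open>K \<ge> 0\<close> by simp
    then have "\<bar>v t\<bar> * B + \<bar>D\<bar> * (\<bar>x t\<bar> * B) \<le> (1 + \<bar>D\<bar>) * (\<bar>x t\<bar> + \<bar>v t\<bar>) * B"
      by (simp add: algebra_simps)
    ultimately have "v t * n2 t + \<bar>D\<bar> * (x t * n1 t) \<le> (1 + \<bar>D\<bar>) * (\<bar>x t\<bar> + \<bar>v t\<bar>) * B"
      by linarith
    also have "\<dots> = (1 + \<bar>D\<bar>) * K * exp (- \<eta> * t) * (\<bar>x t\<bar> + \<bar>v t\<bar>)^2"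
      unfolding B_def by (simp add: power2_eq_square)
    also have "\<dots> \<le> (1 + \<bar>D\<bar>) * K * exp (- \<eta> * t) * (c * Q t)"
      using norm \<open>K \<ge> 0\<close> by (intro mult_left_mono) auto
    finally have pert: "v t * n2 t + \<bar>D\<bar> * (x t * n1 t)
                          \<le> (1 + \<bar>D\<bar>) * K * exp (- \<eta> * t) * (c * Q t)" .
    have "Q' t = - 2 * k * Q t + 2 * (D + \<bar>D\<bar>) * (x t * v t)
                   + 2 * (v t * n2 t + \<bar>D\<bar> * (x t * n1 t))"
      unfolding Q_def Q'_def by (simp add: algebra_simps power2_eq_square)
    also have "\<dots> \<le> - 2 * k * Q t + 2 * s * Q t
                   + 2 * ((1 + \<bar>D\<bar>) * K * exp (- \<eta> * t) * (c * Q t))"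
      by (rule add_mono[OF add_mono[OF order_refl cross] mult_left_mono[OF pert]]) simp
    finally show ?thesis by (simp add: algebra_simps)
  qed
  moreover have "2 * (1 + \<bar>D\<bar>) * K * c \<ge> 0" unfolding c_def using \<open>K \<ge> 0\<close> by simp
  moreover have "Q t \<ge> 0" for t unfolding Q_def by simp
  ultimately obtain C where "C \<ge> 0" and C: "\<forall>t\<ge>T. Q t \<le> C * exp (- (2 * (k - s)) * t)"
    using gronwall_integrable_perturbation[OF \<open>\<eta> > 0\<close> _ _ dQ] by blast
  have "c \<ge> 0" unfolding c_def by simp
  then have "\<bar>x t\<bar> + \<bar>v t\<bar> \<le> sqrt (c * C) * exp (- (k - s) * t)" if "t \<ge> T" for t
    using sum_bound_of_square_bound[OF norm _ \<open>C \<ge> 0\<close>] C that by blast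
  then show ?thesis unfolding s_def by blast
qed

text \<open>
  Here the linear part is a Jordan block. Its flow multiplies both \<open>v\<close> and
  \<open>y = x - t * v\<close> by \<open>exp (- k * t)\<close>, so the time-dependent form \<open>v^2 + y^2\<close> decays
  exactly at rate \<open>2 * k\<close>. The price is that \<open>x = y + t * v\<close> is only controlled up to a factor
  \<open>1 + t\<close>. In the perturbation this factor appears squared and is absorbed by half of the
  exponential.
\<close>
lemma decay_rate_degenerate:
  fixes x v n1 n2 :: "real \<Rightarrow> real"
  assumes "\<eta> > 0" and "K \<ge> 0" and "T \<ge> 0"
    and dx: "\<And>t. t \<ge> T \<Longrightarrow> (x has_real_derivative - k * x t + v t + n1 t) (at t)"
    and dv: "\<And>t. t \<ge> T \<Longrightarrow> (v has_real_derivative - k * v t + n2 t) (at t)"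
    and n1: "\<And>t. t \<ge> T \<Longrightarrow> \<bar>n1 t\<bar> \<le> K * exp (- \<eta> * t) * (\<bar>x t\<bar> + \<bar>v t\<bar>)"
    and n2: "\<And>t. t \<ge> T \<Longrightarrow> \<bar>n2 t\<bar> \<le> K * exp (- \<eta> * t) * (\<bar>x t\<bar> + \<bar>v t\<bar>)"
  shows "\<exists>C. \<forall>t\<ge>T. \<bar>x t\<bar> + \<bar>v t\<bar> \<le> C * (1 + t) * exp (- k * t)"
proof -
  define y where "y = (\<lambda>t. x t - t * v t)"
  define Q where "Q = (\<lambda>t. (v t)^2 + (y t)^2)"
  define Q' where "Q' = (\<lambda>t. - (2 * k) * Q t + 2 * (v t * n2 t + y t * (n1 t - t * n2 t)))"
  \<comment> \<open>Chosen so that \<open>c * (1 + t) \<le> 1 + \<eta> / 4 * t \<le> exp (\<eta> / 4 * t)\<close>.\<close>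
  define c where "c = min 1 (\<eta> / 4)"
  have c: "c > 0" "c \<le> 1" "c \<le> \<eta> / 4" unfolding c_def using \<open>\<eta> > 0\<close> by auto
  have norm: "(\<bar>y t\<bar> + \<bar>v t\<bar>)^2 \<le> 2 * Q t" for t
    unfolding Q_def using sum_squares_bound[of "\<bar>y t\<bar>" "\<bar>v t\<bar>"] by (simp add: power2_sum)
  have xv: "\<bar>x t\<bar> + \<bar>v t\<bar> \<le> (1 + t) * (\<bar>y t\<bar> + \<bar>v t\<bar>)" if "t \<ge> T" for t
  proof -
    have "x t = y t + t * v t" unfolding y_def by simp
    then have "\<bar>x t\<bar> \<le> \<bar>y t\<bar> + t * \<bar>v t\<bar>"
      using abs_triangle_ineq[of "y t" "t * v t"] that \<open>T \<ge> 0\<close> by (simp add: abs_mult)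
    moreover have "t * \<bar>y t\<bar> \<ge> 0" using that \<open>T \<ge> 0\<close> by simp
    ultimately show ?thesis by (simp add: algebra_simps)
  qed
  have dQ: "(Q has_real_derivative Q' t) (at t)" if "t \<ge> T" for t
    unfolding Q_def Q'_def y_def
    by (auto intro!: derivative_eq_intros dx[OF that] dv[OF that]
        simp: algebra_simps power2_eq_square)
  have "Q' t \<le> (- (2 * k) + 4 * K / c^2 * exp (- (\<eta> / 2) * t)) * Q t" if "t \<ge> T" for t
  proof -
    have "t \<ge> 0" using that \<open>T \<ge> 0\<close> by simp
    define B where "B = K * exp (- \<eta> * t) * (\<bar>x t\<bar> + \<bar>v t\<bar>)"
    define N where "N = \<bar>y t\<bar> + \<bar>v t\<bar>"
    have "B \<ge> 0" "N \<ge> 0" unfolding B_def N_def using \<open>K \<ge> 0\<close> by simp_all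
    have "v t * n2 t \<le> \<bar>v t\<bar> * B"
      using n2[OF that] unfolding B_def
      by (rule mult_le_abs_mult_bound)
    also have "\<dots> \<le> \<bar>v t\<bar> * ((1 + t) * B)"
      using \<open>B \<ge> 0\<close> \<open>t \<ge> 0\<close> by (intro mult_left_mono) (auto simp: algebra_simps)
    finally have v_part: "v t * n2 t \<le> \<bar>v t\<bar> * ((1 + t) * B)" .
    have "\<bar>n1 t - t * n2 t\<bar> \<le> \<bar>n1 t\<bar> + t * \<bar>n2 t\<bar>"
      using abs_triangle_ineq4[of "n1 t" "t * n2 t"] \<open>t \<ge> 0\<close> by (simp add: abs_mult)
    also have "\<dots> \<le> B + t * B"
      using n1[OF that] n2[OF that] \<open>t \<ge> 0\<close> unfolding B_def
      by (intro add_mono mult_left_mono) auto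
    finally have "\<bar>n1 t - t * n2 t\<bar> \<le> (1 + t) * B" by (simp add: algebra_simps)
    then have "y t * (n1 t - t * n2 t) \<le> \<bar>y t\<bar> * ((1 + t) * B)"
      by (rule mult_le_abs_mult_bound)
    with v_part have "v t * n2 t + y t * (n1 t - t * n2 t) \<le> N * ((1 + t) * B)"
      unfolding N_def by (simp add: algebra_simps)
    also have "\<dots> \<le> N * ((1 + t) * (K * exp (- \<eta> * t) * ((1 + t) * N)))"
      using xv[OF that] \<open>t \<ge> 0\<close> \<open>K \<ge> 0\<close> \<open>N \<ge> 0\<close> unfolding B_def N_def
      by (intro mult_left_mono) auto
    also have "\<dots> = K * ((1 + t)^2 * exp (- \<eta> * t)) * N^2"
      by (simp add: power2_eq_square)
    finally have pert: "v t * n2 t + y t * (n1 t - t * n2 t)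
                          \<le> K * ((1 + t)^2 * exp (- \<eta> * t)) * N^2" .
    have "c * (1 + t) \<le> 1 + \<eta> / 4 * t"
      using c \<open>t \<ge> 0\<close> mult_right_mono[of c "\<eta> / 4" t] by (simp add: algebra_simps)
    also have "\<dots> \<le> exp (\<eta> / 4 * t)" by (rule exp_ge_add_one_self)
    finally have "(c * (1 + t))^2 \<le> (exp (\<eta> / 4 * t))^2"
      using c \<open>t \<ge> 0\<close> by (intro power_mono) auto
    also have "\<dots> = exp (\<eta> / 2 * t)"
      by (simp add: power2_eq_square flip: exp_add)
    finally have "(1 + t)^2 \<le> exp (\<eta> / 2 * t) / c^2"
      using c by (simp add: pos_le_divide_eq power_mult_distrib mult.commute)
    then have "(1 + t)^2 * exp (- \<eta> * t) \<le> exp (\<eta> / 2 * t) / c^2 * exp (- \<eta> * t)"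
      by (intro mult_right_mono) auto
    also have "\<dots> = exp (- (\<eta> / 2) * t) / c^2"
      by (simp flip: exp_add)
    finally have "K * ((1 + t)^2 * exp (- \<eta> * t)) * N^2
                    \<le> K * (exp (- (\<eta> / 2) * t) / c^2) * (2 * Q t)"
      using \<open>K \<ge> 0\<close> norm[of t] unfolding N_def by (intro mult_mono) auto
    with pert have "v t * n2 t + y t * (n1 t - t * n2 t)
                      \<le> K * (exp (- (\<eta> / 2) * t) / c^2) * (2 * Q t)"
      by (rule order_trans)
    then have "Q' t \<le> - (2 * k) * Q t + 2 * (K * (exp (- (\<eta> / 2) * t) / c^2) * (2 * Q t))"
      unfolding Q'_def by simp
    then show ?thesis by (simp add: algebra_simps)
  qed
  moreover have "4 * K / c^2 \<ge> 0" using \<open>K \<ge> 0\<close> by simp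
  moreover have "Q t \<ge> 0" for t unfolding Q_def by simp
  moreover have "\<eta> / 2 > 0" using \<open>\<eta> > 0\<close> by simp
  ultimately obtain C where "C \<ge> 0" and C: "\<forall>t\<ge>T. Q t \<le> C * exp (- (2 * k) * t)"
    using gronwall_integrable_perturbation[of "\<eta> / 2" "4 * K / c^2" T Q Q' "2 * k"] dQ by blast
  have "\<bar>x t\<bar> + \<bar>v t\<bar> \<le> sqrt (2 * C) * (1 + t) * exp (- k * t)" if "t \<ge> T" for t
  proof -
    have "\<bar>y t\<bar> + \<bar>v t\<bar> \<le> sqrt (2 * C) * exp (- k * t)"
      using sum_bound_of_square_bound[OF norm _ \<open>C \<ge> 0\<close>] C that by simp
    then have "(1 + t) * (\<bar>y t\<bar> + \<bar>v t\<bar>) \<le> (1 + t) * (sqrt (2 * C) * exp (- k * t))"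
      using that \<open>T \<ge> 0\<close> by (intro mult_left_mono) auto
    with xv[OF that] show ?thesis by (simp add: mult_ac)
  qed
  then show ?thesis by blast
qed

section \<open>One-dimensional comparison lemmas\<close>

lemma nondecreasing_of_deriv_within:
  fixes y y' :: "real \<Rightarrow> real"
  assumes "a \<le> b"
    and deriv: "\<And>t. t \<in> {a..b} \<Longrightarrow> (y has_real_derivative y' t) (at t within {a..b})"
    and nonneg: "\<And>t. t \<in> {a..b} \<Longrightarrow> y' t \<ge> 0"
  shows "y a \<le> y b"
proof (rule DERIV_nonneg_imp_increasing_open[OF \<open>a \<le> b\<close>])
  show "continuous_on {a..b} y" using DERIV_continuous_on deriv by blast
  fix t assume "a < t" "t < b"
  then have "at t within {a..b} = at t" by (intro at_within_interior) simp
  then show "\<exists>d. DERIV y t :> d \<and> d \<ge> 0"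
    using deriv[of t] nonneg[of t] \<open>a < t\<close> \<open>t < b\<close> by auto
qed

text \<open>
  With \<open>A\<close> an antiderivative of \<open>k\<close>, the function \<open>y * exp (- A)\<close> is nondecreasing.
\<close>
lemma positive_of_linear_differential_inequality:
  fixes y y' k :: "real \<Rightarrow> real"
  assumes "continuous_on {S..} k"
    and deriv: "\<And>t. t \<ge> S \<Longrightarrow> (y has_real_derivative y' t) (at t within {S..})"
    and ineq: "\<And>t. t \<ge> S \<Longrightarrow> k t * y t \<le> y' t"
    and "y S > 0" and "b \<ge> S"
  shows "y b > 0"
proof -
  define A where "A = (\<lambda>t. integral {S..t} k)"
  have dA: "(A has_real_derivative k t) (at t within {S..b})" if "t \<in> {S..b}" for t
    unfolding A_def
    using integral_has_real_derivative[OF continuous_on_subset[OF assms(1)] that] by auto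
  have dy: "(y has_real_derivative y' t) (at t within {S..b})" if "t \<in> {S..b}" for t
    using deriv[of t] that by (auto intro: DERIV_subset)
  have "y S * exp (- A S) \<le> y b * exp (- A b)"
  proof (rule nondecreasing_of_deriv_within[OF \<open>b \<ge> S\<close>])
    fix t assume t: "t \<in> {S..b}"
    show "((\<lambda>t. y t * exp (- A t)) has_real_derivative (y' t - k t * y t) * exp (- A t))
            (at t within {S..b})"
      by (auto intro!: derivative_eq_intros dA[OF t] dy[OF t] simp: algebra_simps)
    show "(y' t - k t * y t) * exp (- A t) \<ge> 0"
      using ineq[of t] t by simp
  qed
  then have "0 < y b * exp (- A b)"
    using \<open>y S > 0\<close> by (smt (verit) exp_gt_zero mult_pos_pos)
  then show ?thesis by (simp add: zero_less_mult_iff)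
qed

text \<open>
  The derivative has the sign of \<open>z - F\<close>, so \<open>g\<close> is nonincreasing up to \<open>F\<close> and nondecreasing after it.
\<close>
lemma minimum_of_derivative_sign:
  fixes g q :: "real \<Rightarrow> real"
  assumes deriv: "\<And>z. z \<in> {m..M} \<Longrightarrow> (g has_real_derivative (z - F) * q z) (at z)"
    and q: "\<And>z. z \<in> {m..M} \<Longrightarrow> q z \<ge> 0"
    and "F \<in> {m..M}" and "y \<in> {m..M}"
  shows "g F \<le> g y"
proof (cases "F \<le> y")
  case True
  then show ?thesis
  proof (rule DERIV_nonneg_imp_nondecreasing)
    fix z assume "F \<le> z" "z \<le> y"
    then show "\<exists>d. DERIV g z :> d \<and> d \<ge> 0"
      using deriv[of z] q[of z] assms(3,4) by (intro exI[of _ "(z - F) * q z"]) auto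
  qed
next
  case False
  then have "y \<le> F" by simp
  then show ?thesis
  proof (rule DERIV_nonpos_imp_nonincreasing)
    fix z assume "y \<le> z" "z \<le> F"
    then show "\<exists>d. DERIV g z :> d \<and> d \<le> 0"
      using deriv[of z] q[of z] assms(3,4)
      by (intro exI[of _ "(z - F) * q z"]) (auto intro: mult_nonpos_nonneg)
  qed
qed

lemma quadratic_sandwich:
  fixes g q :: "real \<Rightarrow> real"
  assumes deriv: "\<And>z. z \<in> {m..M} \<Longrightarrow> (g has_real_derivative (z - F) * q z) (at z)"
    and q: "\<And>z. z \<in> {m..M} \<Longrightarrow> lo \<le> q z \<and> q z \<le> hi"
    and "F \<in> {m..M}" and "y \<in> {m..M}"
  shows "lo / 2 * (y - F)^2 \<le> g y - g F" and "g y - g F \<le> hi / 2 * (y - F)^2"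
proof -
  have "((\<lambda>z. g z - lo / 2 * (z - F)^2) has_real_derivative (z - F) * (q z - lo)) (at z)"
    if "z \<in> {m..M}" for z
    by (auto intro!: derivative_eq_intros deriv[OF that] simp: field_simps)
  from minimum_of_derivative_sign[OF this _ assms(3,4)]
  show "lo / 2 * (y - F)^2 \<le> g y - g F" using q by simp
  have "((\<lambda>z. hi / 2 * (z - F)^2 - g z) has_real_derivative (z - F) * (hi - q z)) (at z)"
    if "z \<in> {m..M}" for z
    by (auto intro!: derivative_eq_intros deriv[OF that] simp: field_simps)
  from minimum_of_derivative_sign[OF this _ assms(3,4)]
  show "g y - g F \<le> hi / 2 * (y - F)^2" using q by simp
qed

section \<open>The damped oscillator: energy and bounds\<close>

text \<open>
  The oscillator in the original time \<open>t\<close> and with \<open>f\<close> instead of \<open>ln f\<close> as displacement,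
  which keeps both right-hand sides polynomial. The initial time \<open>T\<close> is assumed nonnegative
  so that the weight \<open>1 + t\<close> in the degenerate rate is at least \<open>1\<close>.
\<close>
locale damped_oscillator =
  fixes \<kappa> \<nu> \<beta> F T :: real and f w :: "real \<Rightarrow> real"
  assumes pos: "\<kappa> > 0" "\<nu> > 0" "F > 0"
    and equilibrium: "F + \<nu> * F^2 = \<beta>"
    and T_nonneg: "T \<ge> 0"
    and f_pos: "t \<ge> T \<Longrightarrow> f t > 0"
    and deriv_f: "t \<ge> T \<Longrightarrow> (f has_real_derivative (f t)^2 * w t) (at t)"
    and deriv_w: "t \<ge> T \<Longrightarrow> (w has_real_derivative
          - (\<kappa> * f t + \<nu> * (f t)^2) * w t - \<kappa> * (f t + \<nu> * (f t)^2 - \<beta>)) (at t)"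
begin

text \<open>
  In terms of \<open>u = ln f\<close> the restoring force is the derivative of
  \<open>u + \<nu> * exp u + \<beta> * exp (- u)\<close>, up to the factor \<open>\<kappa>\<close>.
\<close>
definition potential :: "real \<Rightarrow> real" where
  "potential y = ln y + \<nu> * y + \<beta> / y"

definition energy :: "real \<Rightarrow> real" where
  "energy t = (w t)^2 / 2 + \<kappa> * potential (f t)"

lemma beta_pos: "\<beta> > 0"
  using equilibrium pos by (metis add_pos_pos mult_pos_pos zero_less_power)

lemma deriv_potential:
  assumes "y > 0"
  shows "(potential has_real_derivative (y + \<nu> * y^2 - \<beta>) / y^2) (at y)"
  unfolding potential_def using assms
  by (auto intro!: derivative_eq_intros simp: field_simps power2_eq_square)

lemma restoring_force_factorisation:
  "y + \<nu> * y^2 - \<beta> = (y - F) * (1 + \<nu> * (y + F))"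
  by (simp add: algebra_simps power2_eq_square flip: equilibrium)

text \<open>
  The potential is large at both ends of the half line, although \<open>ln y\<close> tends to minus infinity
  as \<open>y\<close> tends to \<open>0\<close>: half of the term \<open>\<beta> / y\<close> compensates the logarithm, by
  \<open>ln z \<le> z - 1\<close> at \<open>z = \<beta> / (2 * y)\<close>.
\<close>
lemma potential_coercive:
  assumes "y > 0"
  shows "\<nu> * y + \<beta> / (2 * y) + 1 + ln (\<beta> / 2) \<le> potential y"
proof -
  have "ln (\<beta> / 2) - ln y = ln (\<beta> / 2 / y)"
    using assms beta_pos by (simp add: ln_div ln_mult)
  also have "\<dots> \<le> \<beta> / 2 / y - 1"
    using assms beta_pos by (intro ln_le_minus_one) simp
  finally show ?thesis
    unfolding potential_def by simp
qed

text \<open>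
  The work of the restoring force cancels the change of potential energy, and only the damping
  is left.
\<close>
lemma deriv_energy:
  assumes "t \<ge> T"
  shows "(energy has_real_derivative - (\<kappa> * f t + \<nu> * (f t)^2) * (w t)^2) (at t)"
proof -
  have "((\<lambda>t. potential (f t)) has_real_derivative
           (f t + \<nu> * (f t)^2 - \<beta>) / (f t)^2 * ((f t)^2 * w t)) (at t)"
    using DERIV_chain2[OF deriv_potential[OF f_pos[OF assms]] deriv_f[OF assms]] .
  then have "((\<lambda>t. potential (f t)) has_real_derivative (f t + \<nu> * (f t)^2 - \<beta>) * w t) (at t)"
    using f_pos[OF assms] by simp
  then show ?thesis
    unfolding energy_def
    by (auto intro!: derivative_eq_intros deriv_w[OF assms]
        simp: field_simps power2_eq_square)
qed

lemma energy_nonincreasing: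
  assumes "t \<ge> T"
  shows "energy t \<le> energy T"
proof (rule DERIV_nonpos_imp_nonincreasing[OF assms])
  fix s assume "T \<le> s"
  have "(\<kappa> * f s + \<nu> * (f s)^2) * (w s)^2 \<ge> 0"
    using f_pos[OF \<open>T \<le> s\<close>] pos by simp
  then have "- (\<kappa> * f s + \<nu> * (f s)^2) * (w s)^2 \<le> 0" by linarith
  then show "\<exists>d. DERIV energy s :> d \<and> d \<le> 0"
    using deriv_energy[OF \<open>T \<le> s\<close>] by blast
qed

lemma orbit_bounds:
  obtains m M where "0 < m" "m \<le> F" "F \<le> M"
    and "\<And>t. t \<ge> T \<Longrightarrow> m \<le> f t \<and> f t \<le> M \<and> \<bar>w t\<bar> \<le> M"
proof -
  \<comment> \<open>What is left for the nonnegative terms of the energy after the constants of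
    \<open>potential_coercive\<close> are moved to the other side.\<close>
  define R where "R = energy T / \<kappa> - 1 - ln (\<beta> / 2)"
  have key: "(w t)^2 / (2 * \<kappa>) + \<nu> * f t + \<beta> / (2 * f t) \<le> R" if "t \<ge> T" for t
  proof -
    have "(w t)^2 / (2 * \<kappa>) + potential (f t) = energy t / \<kappa>"
      unfolding energy_def using pos by (simp add: field_simps)
    also have "\<dots> \<le> energy T / \<kappa>"
      using energy_nonincreasing[OF that] pos by (simp add: divide_right_mono)
    finally show ?thesis
      using potential_coercive[OF f_pos[OF that]] unfolding R_def by linarith
  qed
  have bounds: "R > 0" "\<beta> / (2 * R) \<le> f t" "f t \<le> R / \<nu>" "\<bar>w t\<bar> \<le> sqrt (2 * \<kappa> * R)"
    if "t \<ge> T" for t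
  proof -
    have ft: "f t > 0" using f_pos that by simp
    have terms: "(w t)^2 / (2 * \<kappa>) \<ge> 0" "\<nu> * f t > 0" "\<beta> / (2 * f t) > 0"
      using pos beta_pos ft by simp_all
    then show "R > 0" using key[OF that] by linarith
    have "\<beta> / (2 * f t) \<le> R" using terms key[OF that] by linarith
    then show "\<beta> / (2 * R) \<le> f t" using \<open>R > 0\<close> ft by (simp add: field_simps)
    have "\<nu> * f t \<le> R" using terms key[OF that] by linarith
    then show "f t \<le> R / \<nu>" using pos by (simp add: field_simps)
    have "(w t)^2 / (2 * \<kappa>) \<le> R" using terms key[OF that] by linarith
    then have "(w t)^2 \<le> 2 * \<kappa> * R" using pos by (simp add: field_simps)
    then show "\<bar>w t\<bar> \<le> sqrt (2 * \<kappa> * R)" by (simp add: real_le_rsqrt)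
  qed
  show thesis
  proof
    show "0 < min F (\<beta> / (2 * R))" using pos beta_pos bounds(1)[of T] by simp
    show "min F (\<beta> / (2 * R)) \<le> F" by simp
    show "F \<le> max F (max (R / \<nu>) (sqrt (2 * \<kappa> * R)))" by simp
    show "min F (\<beta> / (2 * R)) \<le> f t \<and> f t \<le> max F (max (R / \<nu>) (sqrt (2 * \<kappa> * R)))
            \<and> \<bar>w t\<bar> \<le> max F (max (R / \<nu>) (sqrt (2 * \<kappa> * R)))" if "t \<ge> T" for t
      using bounds[OF that] by (simp add: le_max_iff_disj min_le_iff_disj)
  qed
qed

text \<open>
  On a compact interval the potential has at \<open>F\<close> a nondegenerate minimum, because
  the restoring force is \<open>y - F\<close> times a factor that is bounded and bounded away from \<open>0\<close>.
\<close>
lemma potential_quadratic: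
  assumes "0 < m" and "F \<in> {m..M}" and "y \<in> {m..M}"
  shows "1 / (2 * M^2) * (y - F)^2 \<le> potential y - potential F"
    and "potential y - potential F \<le> (1 + 2 * \<nu> * M) / (2 * m^2) * (y - F)^2"
proof -
  define q where "q = (\<lambda>z. (1 + \<nu> * (z + F)) / z^2)"
  have deriv: "(potential has_real_derivative (z - F) * q z) (at z)" if "z \<in> {m..M}" for z
    using deriv_potential[of z] restoring_force_factorisation[of z] that \<open>0 < m\<close>
    unfolding q_def by simp
  have q: "1 / M^2 \<le> q z \<and> q z \<le> (1 + 2 * \<nu> * M) / m^2" if "z \<in> {m..M}" for z
  proof
    have "z > 0" "m^2 \<le> z^2" "z^2 \<le> M^2" using that \<open>0 < m\<close> by (auto intro!: power_mono)
    moreover have "\<nu> * (z + F) \<ge> 0" using pos \<open>z > 0\<close> by simp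
    moreover have "\<nu> * (z + F) \<le> \<nu> * (2 * M)"
      using pos that assms(2) by (intro mult_left_mono) auto
    ultimately show "1 / M^2 \<le> q z" "q z \<le> (1 + 2 * \<nu> * M) / m^2"
      unfolding q_def using \<open>0 < m\<close> by (auto intro!: frac_le)
  qed
  show "1 / (2 * M^2) * (y - F)^2 \<le> potential y - potential F"
    "potential y - potential F \<le> (1 + 2 * \<nu> * M) / (2 * m^2) * (y - F)^2"
    using quadratic_sandwich[OF deriv q assms(2,3)] by (simp_all add: mult.commute)
qed

section \<open>Exponential decay from a corrected energy\<close>

text \<open>
  With \<open>h\<close> the restoring force, the derivative of \<open>w * h\<close> contains \<open>- \<kappa> * h^2\<close>, which is
  exactly the dissipation of displacement that the energy lacks. The other terms are absorbed:
  the mixed one by completing a square, and multiples of \<open>w^2\<close> by the damping, provided the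
  weight \<open>\<epsilon>\<close> of \<open>w * h\<close> is small. The same smallness keeps the corrected energy \<open>V\<close>
  comparable to \<open>(f - F)^2 + w^2\<close>, so that \<open>V' \<le> - \<mu> * V\<close>.
\<close>
lemma exponential_decay:
  obtains \<mu> C where "\<mu> > 0" "C \<ge> 0"
    and "\<And>t. t \<ge> T \<Longrightarrow> (f t - F)^2 + (w t)^2 \<le> C * exp (- \<mu> * t)"
proof -
  obtain m M where m: "0 < m" "m \<le> F" "F \<le> M"
    and orbit: "\<And>t. t \<ge> T \<Longrightarrow> m \<le> f t \<and> f t \<le> M \<and> \<bar>w t\<bar> \<le> M"
    using orbit_bounds by blast
  have "M > 0" using m by simp
  define h where "h = (\<lambda>t. f t + \<nu> * (f t)^2 - \<beta>)"
  define H where "H = 1 + 2 * \<nu> * M"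
  define lo where "lo = \<kappa> / (2 * M^2)"
  define hi where "hi = \<kappa> * (1 + 2 * \<nu> * M) / (2 * m^2)"
  define dM where "dM = \<kappa> * M + \<nu> * M^2"
  define B where "B = dM^2 / (2 * \<kappa>) + M^2 * H"
  \<comment> \<open>The three bounds serve, in this order, the kinetic and the potential part of
    \<open>V_cross\<close> and the dissipation in \<open>V'_bound\<close>.\<close>
  define \<epsilon> where "\<epsilon> = min (1 / 2) (min (lo / H^2) (\<kappa> * m / (2 * B)))"
  define V where "V = (\<lambda>t. energy t - \<kappa> * potential F + \<epsilon> * (w t * h t))"
  define V' where "V' = (\<lambda>t. - (\<kappa> * f t + \<nu> * (f t)^2) * (w t)^2
      + \<epsilon> * (- (\<kappa> * f t + \<nu> * (f t)^2) * w t * h t - \<kappa> * (h t)^2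
             + (f t)^2 * (1 + 2 * \<nu> * f t) * (w t)^2))"
  have "H \<ge> 1" "lo > 0" "hi > 0" "dM > 0" unfolding H_def lo_def hi_def dM_def
    using pos m \<open>M > 0\<close> by (simp_all add: add_pos_pos)
  moreover have "B > 0" unfolding B_def using \<open>M > 0\<close> \<open>H \<ge> 1\<close> pos
    by (intro add_nonneg_pos) simp_all
  ultimately have "\<epsilon> > 0" unfolding \<epsilon>_def using pos m by simp
  moreover have "\<epsilon> \<le> 1 / 2" "\<epsilon> \<le> lo / H^2" "\<epsilon> \<le> \<kappa> * m / (2 * B)"
    unfolding \<epsilon>_def by (simp_all only: min.cobounded1 min.coboundedI2 min.cobounded2)
  ultimately have \<epsilon>: "\<epsilon> > 0" "\<epsilon> \<le> 1 / 2" "\<epsilon> \<le> lo / H^2" "\<epsilon> \<le> \<kappa> * m / (2 * B)"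
    by blast+
  then have \<epsilon>H: "\<epsilon> * H^2 \<le> lo" and \<epsilon>B: "\<epsilon> * B \<le> \<kappa> * m / 2"
    using \<open>H \<ge> 1\<close> \<open>B > 0\<close> by (simp_all add: field_simps)
  have dh: "(h has_real_derivative (f t)^2 * (1 + 2 * \<nu> * f t) * w t) (at t)" if "t \<ge> T" for t
    unfolding h_def
    by (auto intro!: derivative_eq_intros deriv_f[OF that] simp: algebra_simps power2_eq_square)
  have dw: "(w has_real_derivative - (\<kappa> * f t + \<nu> * (f t)^2) * w t - \<kappa> * h t) (at t)"
    if "t \<ge> T" for t
    using deriv_w[OF that] unfolding h_def .
  have dV: "(V has_real_derivative V' t) (at t)" if "t \<ge> T" for t
    unfolding V_def V'_def
    by (auto intro!: derivative_eq_intros deriv_energy[OF that] dw[OF that] dh[OF that])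
      (simp add: algebra_simps power2_eq_square)
  have h_bounds: "\<bar>f t - F\<bar> \<le> \<bar>h t\<bar>" "\<bar>h t\<bar> \<le> H * \<bar>f t - F\<bar>" if "t \<ge> T" for t
  proof -
    have "0 \<le> \<nu> * (f t + F)" "\<nu> * (f t + F) \<le> \<nu> * (2 * M)"
      using pos orbit[OF that] m by (auto intro!: mult_left_mono)
    then have factor: "1 \<le> 1 + \<nu> * (f t + F)" "1 + \<nu> * (f t + F) \<le> H"
      unfolding H_def by auto
    have "\<bar>h t\<bar> = (1 + \<nu> * (f t + F)) * \<bar>f t - F\<bar>"
      unfolding h_def restoring_force_factorisation using factor by (simp add: abs_mult)
    then show "\<bar>f t - F\<bar> \<le> \<bar>h t\<bar>" "\<bar>h t\<bar> \<le> H * \<bar>f t - F\<bar>"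
      using factor mult_right_mono[OF factor(1), of "\<bar>f t - F\<bar>"]
        mult_right_mono[OF factor(2), of "\<bar>f t - F\<bar>"] by auto
  qed
  have h_sq: "(f t - F)^2 \<le> (h t)^2" "(h t)^2 \<le> H^2 * (f t - F)^2" if "t \<ge> T" for t
  proof -
    show "(f t - F)^2 \<le> (h t)^2"
      using h_bounds(1)[OF that] by (simp add: abs_le_square_iff)
    have "\<bar>h t\<bar>^2 \<le> (H * \<bar>f t - F\<bar>)^2"
      using h_bounds(2)[OF that] by (intro power_mono) auto
    then show "(h t)^2 \<le> H^2 * (f t - F)^2" by (simp add: power_mult_distrib)
  qed
  have V_cross: "\<bar>\<epsilon> * (w t * h t)\<bar> \<le> (w t)^2 / 4 + lo / 2 * (f t - F)^2" if "t \<ge> T" for t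
  proof -
    have "2 * (\<bar>w t\<bar> * \<bar>h t\<bar>) \<le> (w t)^2 + (h t)^2"
      using sum_squares_bound[of "\<bar>w t\<bar>" "\<bar>h t\<bar>"] by simp
    also have "\<dots> \<le> (w t)^2 + H^2 * (f t - F)^2"
      using h_sq[OF that] by simp
    finally have "\<epsilon> * (\<bar>w t\<bar> * \<bar>h t\<bar>) \<le> \<epsilon> * (((w t)^2 + H^2 * (f t - F)^2) / 2)"
      using \<epsilon> by (intro mult_left_mono) simp_all
    also have "\<dots> = \<epsilon> * ((w t)^2 / 2) + \<epsilon> * H^2 * ((f t - F)^2 / 2)"
      by (simp add: field_simps)
    also have "\<dots> \<le> 1 / 2 * ((w t)^2 / 2) + lo * ((f t - F)^2 / 2)"
      using \<epsilon> \<epsilon>H by (intro add_mono mult_right_mono) simp_all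
    finally show ?thesis using \<epsilon> by (simp add: abs_mult)
  qed
  have pot: "lo * (f t - F)^2 \<le> \<kappa> * (potential (f t) - potential F)"
    "\<kappa> * (potential (f t) - potential F) \<le> hi * (f t - F)^2" if "t \<ge> T" for t
  proof -
    have mem: "F \<in> {m..M}" "f t \<in> {m..M}" using orbit[OF that] m by auto
    show "lo * (f t - F)^2 \<le> \<kappa> * (potential (f t) - potential F)"
      using mult_left_mono[OF potential_quadratic(1)[OF m(1) mem], of \<kappa>] pos
      unfolding lo_def by simp
    show "\<kappa> * (potential (f t) - potential F) \<le> hi * (f t - F)^2"
      using mult_left_mono[OF potential_quadratic(2)[OF m(1) mem], of \<kappa>] pos
      unfolding hi_def by simp
  qed
  define lower where "lower = min (1 / 4) (lo / 2)"
  define upper where "upper = max (3 / 4) (hi + lo / 2)"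
  define dissip where "dissip = min (\<kappa> * m / 2) (\<epsilon> * \<kappa> / 2)"
  have "lower > 0" "upper > 0" "dissip > 0"
    unfolding lower_def upper_def dissip_def using \<open>lo > 0\<close> \<epsilon> pos m by auto
  have V_lower: "lower * ((f t - F)^2 + (w t)^2) \<le> V t"
    and V_upper: "V t \<le> upper * ((f t - F)^2 + (w t)^2)" if "t \<ge> T" for t
  proof -
    have V: "V t = (w t)^2 / 2 + \<kappa> * (potential (f t) - potential F) + \<epsilon> * (w t * h t)"
      unfolding V_def energy_def by (simp add: algebra_simps)
    have "lower * (f t - F)^2 + lower * (w t)^2 \<le> lo / 2 * (f t - F)^2 + 1 / 4 * (w t)^2"
      unfolding lower_def by (intro add_mono mult_right_mono) auto
    then show "lower * ((f t - F)^2 + (w t)^2) \<le> V t"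
      using V_cross[OF that] pot(1)[OF that] unfolding V distrib_left by linarith
    have "(hi + lo / 2) * (f t - F)^2 + 3 / 4 * (w t)^2
            \<le> upper * (f t - F)^2 + upper * (w t)^2"
      unfolding upper_def by (intro add_mono mult_right_mono) auto
    then show "V t \<le> upper * ((f t - F)^2 + (w t)^2)"
      using V_cross[OF that] pot(2)[OF that] unfolding V distrib_left distrib_right by linarith
  qed
  have V'_bound: "V' t \<le> - dissip * ((f t - F)^2 + (w t)^2)" if "t \<ge> T" for t
  proof -
    define d where "d = \<kappa> * f t + \<nu> * (f t)^2"
    note o = orbit[OF that]
    have ft: "f t > 0" using f_pos[OF that] .
    have f2: "(f t)^2 \<le> M^2" using o ft by (intro power_mono) auto
    have d: "d \<ge> \<kappa> * m" "d \<le> dM" "d \<ge> 0"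
    proof -
      have "\<kappa> * m \<le> \<kappa> * f t" "\<nu> * (f t)^2 \<ge> 0" "\<kappa> * f t \<ge> 0" using o pos ft by simp_all
      then show "d \<ge> \<kappa> * m" "d \<ge> 0" unfolding d_def by linarith+
      show "d \<le> dM" unfolding d_def dM_def using o pos f2 by (intro add_mono mult_left_mono) auto
    qed
    \<comment> \<open>Completing the square costs half of the good term \<open>- \<kappa> * h^2\<close>.\<close>
    have "0 \<le> (d * w t + \<kappa> * h t)^2 / (2 * \<kappa>)" using pos by simp
    also have "\<dots> = d^2 / (2 * \<kappa>) * (w t)^2 + d * w t * h t + \<kappa> / 2 * (h t)^2"
      using pos by (simp add: field_simps power2_eq_square)
    finally have "- d * w t * h t \<le> d^2 / (2 * \<kappa>) * (w t)^2 + \<kappa> / 2 * (h t)^2" by simp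
    moreover have "d^2 / (2 * \<kappa>) * (w t)^2 \<le> dM^2 / (2 * \<kappa>) * (w t)^2"
      using d pos by (intro mult_right_mono divide_right_mono power_mono) auto
    moreover have "(f t)^2 * (1 + 2 * \<nu> * f t) * (w t)^2 \<le> M^2 * H * (w t)^2"
      unfolding H_def using f2 o ft pos by (intro mult_right_mono mult_mono) auto
    ultimately have "- d * w t * h t - \<kappa> * (h t)^2 + (f t)^2 * (1 + 2 * \<nu> * f t) * (w t)^2
                       \<le> B * (w t)^2 - \<kappa> / 2 * (h t)^2"
      unfolding B_def distrib_right by linarith
    then have "\<epsilon> * (- d * w t * h t - \<kappa> * (h t)^2 + (f t)^2 * (1 + 2 * \<nu> * f t) * (w t)^2)
                 \<le> \<epsilon> * (B * (w t)^2 - \<kappa> / 2 * (h t)^2)"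
      using \<epsilon> by (intro mult_left_mono) auto
    also have "\<dots> = \<epsilon> * B * (w t)^2 - \<epsilon> * \<kappa> / 2 * (h t)^2" by (simp add: algebra_simps)
    also have "\<dots> \<le> \<kappa> * m / 2 * (w t)^2 - \<epsilon> * \<kappa> / 2 * (f t - F)^2"
      using \<epsilon>B \<epsilon> pos h_sq(1)[OF that] by (intro diff_mono mult_right_mono mult_left_mono) auto
    finally have "V' t \<le> - d * (w t)^2 + \<kappa> * m / 2 * (w t)^2 - \<epsilon> * \<kappa> / 2 * (f t - F)^2"
      unfolding V'_def d_def[symmetric] by linarith
    moreover have "\<kappa> * m * (w t)^2 \<le> d * (w t)^2" using d by (intro mult_right_mono) auto
    moreover have "dissip * (f t - F)^2 + dissip * (w t)^2
                     \<le> \<epsilon> * \<kappa> / 2 * (f t - F)^2 + \<kappa> * m / 2 * (w t)^2"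
      unfolding dissip_def by (intro add_mono mult_right_mono) auto
    ultimately show ?thesis by (simp add: algebra_simps)
  qed
  define \<mu> where "\<mu> = dissip / upper"
  have "\<mu> > 0" unfolding \<mu>_def using \<open>dissip > 0\<close> \<open>upper > 0\<close> by simp
  \<comment> \<open>The Gronwall lemma with zero perturbation; the exponent \<open>1\<close> is arbitrary.\<close>
  have "V' t \<le> (- \<mu> + 0 * exp (- 1 * t)) * V t" if "t \<ge> T" for t
  proof -
    have "\<mu> * V t \<le> \<mu> * (upper * ((f t - F)^2 + (w t)^2))"
      using V_upper[OF that] \<open>\<mu> > 0\<close> by (intro mult_left_mono) auto
    also have "\<dots> = dissip * ((f t - F)^2 + (w t)^2)"
      unfolding \<mu>_def using \<open>upper > 0\<close> by simp
    finally show ?thesis using V'_bound[OF that] by simp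
  qed
  moreover have "V t \<ge> 0" if "t \<ge> T" for t
  proof -
    have "0 \<le> lower * ((f t - F)^2 + (w t)^2)" using \<open>lower > 0\<close> by simp
    then show ?thesis using V_lower[OF that] by (rule order_trans)
  qed
  ultimately obtain C where "C \<ge> 0" and C: "\<forall>t\<ge>T. V t \<le> C * exp (- \<mu> * t)"
    using gronwall_integrable_perturbation[of 1 0 T V V' \<mu>] dV by auto
  show thesis
  proof
    show "\<mu> > 0" by fact
    show "C / lower \<ge> 0" using \<open>C \<ge> 0\<close> \<open>lower > 0\<close> by simp
    show "(f t - F)^2 + (w t)^2 \<le> C / lower * exp (- \<mu> * t)" if "t \<ge> T" for t
    proof -
      have "lower * ((f t - F)^2 + (w t)^2) \<le> C * exp (- \<mu> * t)"
        using V_lower[OF that] C that by (meson order_trans)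
      then show ?thesis using \<open>lower > 0\<close> by (simp add: field_simps)
    qed
  qed
qed

section \<open>Linearisation at the equilibrium\<close>

definition damping :: real where
  "damping = (\<kappa> * F + \<nu> * F^2) / 2"

text \<open>
  A quarter of the discriminant of the characteristic polynomial
  \<open>z^2 + 2 * damping * z + \<kappa> * F^2 * (1 + 2 * \<nu> * F)\<close> of the linearisation, so the
  eigenvalues are \<open>- damping \<plusminus> sqrt discriminant\<close>.
\<close>
definition discriminant :: real where
  "discriminant = damping^2 - \<kappa> * F^2 * (1 + 2 * \<nu> * F)"

text \<open>
  To first order \<open>F^2 * w\<close> is the derivative of \<open>x = f - F\<close>. Adding \<open>damping * x\<close> makes both
  diagonal entries of the linearised system equal to \<open>- damping\<close> and leaves
  \<open>1\<close> and \<open>discriminant\<close> off the diagonal.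
\<close>
definition shifted_velocity :: "real \<Rightarrow> real" where
  "shifted_velocity t = F^2 * w t + damping * (f t - F)"

text \<open>
  The remainders are at least quadratic, and each of their terms has the factor \<open>f - F\<close>
  together with a second factor \<open>f - F\<close> or \<open>w\<close>. Bounding that second factor by the exponential
  decay already known leaves linear terms with exponentially small coefficients.
\<close>
lemma linearisation:
  obtains \<eta> K n1 n2 where "\<eta> > 0" "K \<ge> 0"
    and "\<And>t. t \<ge> T \<Longrightarrow> ((\<lambda>t. f t - F) has_real_derivative
           - damping * (f t - F) + shifted_velocity t + n1 t) (at t)"
    and "\<And>t. t \<ge> T \<Longrightarrow> (shifted_velocity has_real_derivative
           - damping * shifted_velocity t + discriminant * (f t - F) + n2 t) (at t)"
    and "\<And>t. t \<ge> T \<Longrightarrow> \<bar>n1 t\<bar> \<le> K * exp (- \<eta> * t) * (\<bar>f t - F\<bar> + \<bar>shifted_velocity t\<bar>)"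
    and "\<And>t. t \<ge> T \<Longrightarrow> \<bar>n2 t\<bar> \<le> K * exp (- \<eta> * t) * (\<bar>f t - F\<bar> + \<bar>shifted_velocity t\<bar>)"
proof -
  obtain m M where m: "0 < m" "m \<le> F" "F \<le> M"
    and orbit: "\<And>t. t \<ge> T \<Longrightarrow> m \<le> f t \<and> f t \<le> M \<and> \<bar>w t\<bar> \<le> M"
    using orbit_bounds by blast
  obtain \<mu> C where "\<mu> > 0" "C \<ge> 0"
    and decay: "\<And>t. t \<ge> T \<Longrightarrow> (f t - F)^2 + (w t)^2 \<le> C * exp (- \<mu> * t)"
    using exponential_decay by blast
  define \<delta> where "\<delta> = (\<lambda>t. sqrt C * exp (- (\<mu> / 2) * t))"
  define n1 where "n1 = (\<lambda>t. (f t + F) * (f t - F) * w t)"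
  define n2 where "n2 = (\<lambda>t. damping * n1 t - F^2 * (\<kappa> + \<nu> * (f t + F)) * ((f t - F) * w t)
                               - \<kappa> * \<nu> * F^2 * (f t - F)^2)"
  define K1 where "K1 = 2 * M"
  define K2 where "K2 = damping * K1 + F^2 * (\<kappa> + \<nu> * K1) + \<kappa> * \<nu> * F^2"
  have "damping \<ge> 0" unfolding damping_def using pos by simp
  have "K1 \<ge> 0" unfolding K1_def using m by simp
  then have "K2 \<ge> 0" unfolding K2_def using \<open>damping \<ge> 0\<close> pos by simp
  have small: "\<bar>f t - F\<bar> \<le> \<delta> t" "\<bar>w t\<bar> \<le> \<delta> t" if "t \<ge> T" for t
  proof -
    have "exp (- \<mu> * t) = (exp (- (\<mu> / 2) * t))^2"
      by (simp add: power2_eq_square flip: exp_add)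
    then have "(f t - F)^2 + (w t)^2 \<le> (\<delta> t)^2"
      using decay[OF that] \<open>C \<ge> 0\<close> unfolding \<delta>_def by (simp add: power_mult_distrib)
    moreover have "(f t - F)^2 \<ge> 0" "(w t)^2 \<ge> 0" by simp_all
    ultimately have "(f t - F)^2 \<le> (\<delta> t)^2" "(w t)^2 \<le> (\<delta> t)^2" by linarith+
    moreover have "\<delta> t \<ge> 0" unfolding \<delta>_def using \<open>C \<ge> 0\<close> by simp
    ultimately show "\<bar>f t - F\<bar> \<le> \<delta> t" "\<bar>w t\<bar> \<le> \<delta> t"
      by (simp_all add: abs_le_square_iff[symmetric])
  qed
  have bounds: "\<bar>n1 t\<bar> \<le> K1 * (\<delta> t * \<bar>f t - F\<bar>)" "\<bar>n2 t\<bar> \<le> K2 * (\<delta> t * \<bar>f t - F\<bar>)"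
    if "t \<ge> T" for t
  proof -
    have ft: "f t > 0" "f t + F \<le> K1" using f_pos orbit that m unfolding K1_def by fastforce+
    have xw: "\<bar>(f t - F) * w t\<bar> \<le> \<delta> t * \<bar>f t - F\<bar>"
      using mult_left_mono[OF small(2)[OF that], of "\<bar>f t - F\<bar>"] by (simp add: abs_mult mult.commute)
    have xx: "(f t - F)^2 \<le> \<delta> t * \<bar>f t - F\<bar>"
      using mult_right_mono[OF small(1)[OF that], of "\<bar>f t - F\<bar>"] by (simp add: power2_eq_square)
    have "\<bar>n1 t\<bar> = (f t + F) * \<bar>(f t - F) * w t\<bar>"
      unfolding n1_def using ft pos by (simp add: abs_mult)
    also have "\<dots> \<le> K1 * (\<delta> t * \<bar>f t - F\<bar>)"
      using ft pos xw \<open>K1 \<ge> 0\<close> by (intro mult_mono) auto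
    finally show n1_bound: "\<bar>n1 t\<bar> \<le> K1 * (\<delta> t * \<bar>f t - F\<bar>)" .
    have "\<bar>damping * n1 t\<bar> \<le> damping * (K1 * (\<delta> t * \<bar>f t - F\<bar>))"
      using n1_bound \<open>damping \<ge> 0\<close> by (simp add: abs_mult mult_left_mono)
    moreover have "\<bar>F^2 * (\<kappa> + \<nu> * (f t + F)) * ((f t - F) * w t)\<bar>
                     \<le> F^2 * (\<kappa> + \<nu> * K1) * (\<delta> t * \<bar>f t - F\<bar>)"
    proof -
      have coef: "0 \<le> F^2 * (\<kappa> + \<nu> * (f t + F))"
        "F^2 * (\<kappa> + \<nu> * (f t + F)) \<le> F^2 * (\<kappa> + \<nu> * K1)"
        using ft pos by (auto intro!: mult_left_mono)
      then show ?thesis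
        using xw abs_mult[of "F^2 * (\<kappa> + \<nu> * (f t + F))" "(f t - F) * w t"]
          mult_mono[OF coef(2) xw] by simp
    qed
    moreover have "\<bar>\<kappa> * \<nu> * F^2 * (f t - F)^2\<bar> \<le> \<kappa> * \<nu> * F^2 * (\<delta> t * \<bar>f t - F\<bar>)"
      using xx pos by (simp add: abs_mult mult_left_mono)
    ultimately show "\<bar>n2 t\<bar> \<le> K2 * (\<delta> t * \<bar>f t - F\<bar>)"
      unfolding n2_def K2_def distrib_right mult.assoc[of damping] by linarith
  qed
  define K where "K = (K1 + K2) * sqrt C"
  have final: "\<bar>y\<bar> \<le> K * exp (- (\<mu> / 2) * t) * (\<bar>f t - F\<bar> + \<bar>shifted_velocity t\<bar>)"
    if "\<bar>y\<bar> \<le> L * (\<delta> t * \<bar>f t - F\<bar>)" "0 \<le> L" "L \<le> K1 + K2" for y L t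
  proof -
    have "\<delta> t \<ge> 0" unfolding \<delta>_def using \<open>C \<ge> 0\<close> by simp
    then have "L * (\<delta> t * \<bar>f t - F\<bar>) \<le> (K1 + K2) * (\<delta> t * (\<bar>f t - F\<bar> + \<bar>shifted_velocity t\<bar>))"
      using that by (intro mult_mono) auto
    with that(1) show ?thesis unfolding K_def \<delta>_def by (simp add: mult_ac)
  qed
  show thesis
  proof
    show "\<mu> / 2 > 0" using \<open>\<mu> > 0\<close> by simp
    show "K \<ge> 0" unfolding K_def using \<open>K1 \<ge> 0\<close> \<open>K2 \<ge> 0\<close> \<open>C \<ge> 0\<close> by simp
    fix t assume t: "t \<ge> T"
    show "((\<lambda>t. f t - F) has_real_derivative - damping * (f t - F) + shifted_velocity t + n1 t) (at t)"
      unfolding shifted_velocity_def n1_def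
      by (auto intro!: derivative_eq_intros deriv_f[OF t] simp: algebra_simps power2_eq_square)
    have "F^2 * (- (\<kappa> * f t + \<nu> * (f t)^2) * w t - \<kappa> * (f t + \<nu> * (f t)^2 - \<beta>))
            + damping * ((f t)^2 * w t)
          = - damping * shifted_velocity t + discriminant * (f t - F) + n2 t"
      unfolding restoring_force_factorisation shifted_velocity_def discriminant_def n2_def n1_def damping_def
      by (simp add: field_simps power2_eq_square)
    moreover have "(shifted_velocity has_real_derivative
        F^2 * (- (\<kappa> * f t + \<nu> * (f t)^2) * w t - \<kappa> * (f t + \<nu> * (f t)^2 - \<beta>))
            + damping * ((f t)^2 * w t)) (at t)"
      unfolding shifted_velocity_def
      by (auto intro!: derivative_eq_intros deriv_f[OF t] deriv_w[OF t])
    ultimately show "(shifted_velocity has_real_derivative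
        - damping * shifted_velocity t + discriminant * (f t - F) + n2 t) (at t)" by simp
    show "\<bar>n1 t\<bar> \<le> K * exp (- (\<mu> / 2) * t) * (\<bar>f t - F\<bar> + \<bar>shifted_velocity t\<bar>)"
      using final[OF bounds(1)[OF t]] \<open>K1 \<ge> 0\<close> \<open>K2 \<ge> 0\<close> by simp
    show "\<bar>n2 t\<bar> \<le> K * exp (- (\<mu> / 2) * t) * (\<bar>f t - F\<bar> + \<bar>shifted_velocity t\<bar>)"
      using final[OF bounds(2)[OF t]] \<open>K1 \<ge> 0\<close> \<open>K2 \<ge> 0\<close> by simp
  qed
qed

lemma deviation_le_shifted_velocity:
  "\<bar>f t - F\<bar> + \<bar>w t\<bar> \<le> (1 + (1 + damping) / F^2) * (\<bar>f t - F\<bar> + \<bar>shifted_velocity t\<bar>)"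
proof -
  have "damping \<ge> 0" unfolding damping_def using pos by simp
  have "w t = (shifted_velocity t - damping * (f t - F)) / F^2"
    unfolding shifted_velocity_def using pos by simp
  then have "\<bar>w t\<bar> = \<bar>shifted_velocity t - damping * (f t - F)\<bar> / F^2"
    by simp
  also have "\<dots> \<le> (\<bar>shifted_velocity t\<bar> + damping * \<bar>f t - F\<bar>) / F^2"
    using abs_triangle_ineq4[of "shifted_velocity t" "damping * (f t - F)"] \<open>damping \<ge> 0\<close>
    by (intro divide_right_mono) (auto simp: abs_mult)
  also have "\<dots> \<le> ((1 + damping) * (\<bar>f t - F\<bar> + \<bar>shifted_velocity t\<bar>)) / F^2"
    using \<open>damping \<ge> 0\<close> by (intro divide_right_mono) (auto simp: algebra_simps)
  finally have "\<bar>f t - F\<bar> + \<bar>w t\<bar> \<le> (\<bar>f t - F\<bar> + \<bar>shifted_velocity t\<bar>)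
                  + ((1 + damping) * (\<bar>f t - F\<bar> + \<bar>shifted_velocity t\<bar>)) / F^2"
    using abs_ge_zero[of "shifted_velocity t"] by linarith
  then show ?thesis by (simp add: distrib_right)
qed

lemma rate_of_convergence:
  "discriminant \<noteq> 0 \<Longrightarrow>
     \<exists>C. \<forall>t\<ge>T. \<bar>f t - F\<bar> + \<bar>w t\<bar> \<le> C * exp (- (damping - sqrt (max discriminant 0)) * t)"
  "discriminant = 0 \<Longrightarrow>
     \<exists>C. \<forall>t\<ge>T. \<bar>f t - F\<bar> + \<bar>w t\<bar> \<le> C * (1 + t) * exp (- damping * t)"
proof -
  obtain \<eta> K n1 n2 where lin: "\<eta> > 0" "K \<ge> 0"
    and dx: "\<And>t. t \<ge> T \<Longrightarrow> ((\<lambda>t. f t - F) has_real_derivative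
           - damping * (f t - F) + shifted_velocity t + n1 t) (at t)"
    and dv: "\<And>t. t \<ge> T \<Longrightarrow> (shifted_velocity has_real_derivative
           - damping * shifted_velocity t + discriminant * (f t - F) + n2 t) (at t)"
    and n: "\<And>t. t \<ge> T \<Longrightarrow> \<bar>n1 t\<bar> \<le> K * exp (- \<eta> * t) * (\<bar>f t - F\<bar> + \<bar>shifted_velocity t\<bar>)"
      "\<And>t. t \<ge> T \<Longrightarrow> \<bar>n2 t\<bar> \<le> K * exp (- \<eta> * t) * (\<bar>f t - F\<bar> + \<bar>shifted_velocity t\<bar>)"
    using linearisation by blast
  define c where "c = 1 + (1 + damping) / F^2"
  have "damping \<ge> 0" unfolding damping_def using pos by simp
  then have "c \<ge> 0" unfolding c_def by simp
  have transfer: "\<bar>f t - F\<bar> + \<bar>w t\<bar> \<le> c * b" if "\<bar>f t - F\<bar> + \<bar>shifted_velocity t\<bar> \<le> b" for t b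
    using deviation_le_shifted_velocity[of t] mult_left_mono[OF that \<open>c \<ge> 0\<close>] unfolding c_def by linarith
  show "\<exists>C. \<forall>t\<ge>T. \<bar>f t - F\<bar> + \<bar>w t\<bar> \<le> C * exp (- (damping - sqrt (max discriminant 0)) * t)"
    if nonzero: "discriminant \<noteq> 0"
  proof -
    obtain C where "\<forall>t\<ge>T. \<bar>f t - F\<bar> + \<bar>shifted_velocity t\<bar>
                      \<le> C * exp (- (damping - sqrt (max discriminant 0)) * t)"
      using decay_rate_nondegenerate
        [where x = "\<lambda>t. f t - F" and v = shifted_velocity, OF lin nonzero dx dv n] by blast
    then show ?thesis
      using transfer by (intro exI[of _ "c * C"]) (simp only: mult.assoc, blast)
  qed
  show "\<exists>C. \<forall>t\<ge>T. \<bar>f t - F\<bar> + \<bar>w t\<bar> \<le> C * (1 + t) * exp (- damping * t)"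
    if "discriminant = 0"
  proof -
    have "(shifted_velocity has_real_derivative - damping * shifted_velocity t + n2 t) (at t)" if "t \<ge> T" for t
      using dv[OF that] \<open>discriminant = 0\<close> by simp
    from decay_rate_degenerate[where x = "\<lambda>t. f t - F" and v = shifted_velocity, OF lin T_nonneg dx this n]
    obtain C where "\<forall>t\<ge>T. \<bar>f t - F\<bar> + \<bar>shifted_velocity t\<bar> \<le> C * (1 + t) * exp (- damping * t)"
      by blast
    then show ?thesis
      using transfer by (intro exI[of _ "c * C"]) (simp only: mult.assoc, blast)
  qed
qed

lemma tendsto_equilibrium:
  shows "(f \<longlongrightarrow> F) at_top" and "(w \<longlongrightarrow> 0) at_top"
proof -
  obtain \<mu> C where "\<mu> > 0" "C \<ge> 0"
    and decay: "\<And>t. t \<ge> T \<Longrightarrow> (f t - F)^2 + (w t)^2 \<le> C * exp (- \<mu> * t)"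
    using exponential_decay by blast
  have "filterlim (\<lambda>t. \<mu> * t) at_top at_top"
    using \<open>\<mu> > 0\<close> by (intro filterlim_tendsto_pos_mult_at_top[OF tendsto_const]) (auto intro: filterlim_ident)
  then have "((\<lambda>t. exp (- \<mu> * t)) \<longlongrightarrow> 0) at_top"
    by (intro filterlim_compose[OF exp_at_bot]) (simp add: filterlim_uminus_at_top)
  then have to_zero: "((\<lambda>t. C * exp (- \<mu> * t)) \<longlongrightarrow> 0) at_top"
    by (rule tendsto_mult_right_zero)
  have squeeze: "(g \<longlongrightarrow> 0) at_top" if "\<And>t. t \<ge> T \<Longrightarrow> (g t)^2 \<le> C * exp (- \<mu> * t)" for g :: "real \<Rightarrow> real"
  proof -
    have "((\<lambda>t. (g t)^2) \<longlongrightarrow> 0) at_top"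
      by (rule tendsto_sandwich[OF _ _ tendsto_const to_zero])
        (use that in \<open>auto intro: eventually_at_top_linorderI[of T]\<close>)
    from tendsto_real_sqrt[OF this] show ?thesis by (simp add: tendsto_rabs_zero_iff)
  qed
  have "((\<lambda>t. f t - F) \<longlongrightarrow> 0) at_top"
    by (rule squeeze) (use decay in \<open>smt (verit) zero_le_power2\<close>)
  then show "(f \<longlongrightarrow> F) at_top" by (simp add: LIM_zero_iff)
  show "(w \<longlongrightarrow> 0) at_top"
    by (rule squeeze) (use decay in \<open>smt (verit) zero_le_power2\<close>)
qed

end

section \<open>From the rheological system to the oscillator\<close>

lemma ode_solution_deriv:
  assumes "lam > 0" and "ode_solution lam G \<xi> \<nu> a \<tau>0 f0 \<tau> f" and "t \<ge> 0"
  shows "(\<tau> has_real_derivative (G * a - f t * \<tau> t) / lam) (at t within {0..})"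
    and "(f has_real_derivative (-1 + \<xi> * \<bar>\<tau> t\<bar>) * (f t)^2 - \<nu> * (f t)^3) (at t within {0..})"
proof -
  obtain \<tau>' f' where d: "(\<tau> has_real_derivative \<tau>') (at t within {0..})"
    "(f has_real_derivative f') (at t within {0..})"
    and eq: "lam * \<tau>' = - f t * \<tau> t + G * a"
    "f' = (-1 + \<xi> * \<bar>\<tau> t\<bar>) * (f t)^2 - \<nu> * (f t)^3"
    using assms(2,3) unfolding ode_solution_def by blast
  have "\<tau>' = (G * a - f t * \<tau> t) / lam"
    using eq(1) \<open>lam > 0\<close> by (simp add: field_simps)
  with d eq(2) show "(\<tau> has_real_derivative (G * a - f t * \<tau> t) / lam) (at t within {0..})"
    "(f has_real_derivative (-1 + \<xi> * \<bar>\<tau> t\<bar>) * (f t)^2 - \<nu> * (f t)^3) (at t within {0..})"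
    by simp_all
qed

lemma ode_solution_continuous:
  assumes "lam > 0" and "ode_solution lam G \<xi> \<nu> a \<tau>0 f0 \<tau> f"
  shows "continuous_on {0..} \<tau>" and "continuous_on {0..} f"
  using ode_solution_deriv[OF assms] by (auto intro!: DERIV_continuous_on)

text \<open>
  The equation for \<open>f\<close> is linear homogeneous with a continuous coefficient, once the solution is
  inserted into that coefficient.
\<close>
lemma fluidity_positive:
  assumes "lam > 0" and "f0 > 0" and "ode_solution lam G \<xi> \<nu> a \<tau>0 f0 \<tau> f" and "t \<ge> 0"
  shows "f t > 0"
proof (rule positive_of_linear_differential_inequality[OF _ _ _ _ \<open>t \<ge> 0\<close>])
  show "continuous_on {0..} (\<lambda>t. (-1 + \<xi> * \<bar>\<tau> t\<bar>) * f t - \<nu> * (f t)^2)"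
    using ode_solution_continuous[OF assms(1,3)] by (intro continuous_intros)
  show "((-1 + \<xi> * \<bar>\<tau> s\<bar>) * f s - \<nu> * (f s)^2) * f s
          \<le> (-1 + \<xi> * \<bar>\<tau> s\<bar>) * (f s)^2 - \<nu> * (f s)^3" for s
    by (simp add: algebra_simps power2_eq_square power3_eq_cube)
  show "f 0 > 0" using assms(2,3) unfolding ode_solution_def by simp
qed (rule ode_solution_deriv[OF assms(1,3)])

text \<open>
  While \<open>\<tau> \<le> 0\<close>, its derivative is at least \<open>G * a / lam\<close>, so \<open>\<tau>\<close> becomes positive in
  finite time. It stays positive because \<open>\<tau>' \<ge> - f / lam * \<tau>\<close>.
\<close>
lemma stress_eventually_positive:
  assumes "lam > 0" and "G > 0" and "a > 0" and "f0 > 0"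
    and "ode_solution lam G \<xi> \<nu> a \<tau>0 f0 \<tau> f"
  obtains T where "T > 0" and "\<And>t. t \<ge> T \<Longrightarrow> \<tau> t > 0"
proof -
  note d\<tau> = ode_solution_deriv(1)[OF assms(1,5)]
  note f_pos = fluidity_positive[OF assms(1,4,5)]
  define b where "b = G * a / lam"
  have "b > 0" unfolding b_def using assms by simp
  obtain S where "S > 0" "\<tau> S > 0"
  proof (rule ccontr)
    assume "\<not> thesis"
    with that have nonpos: "\<tau> t \<le> 0" if "t > 0" for t using \<open>t > 0\<close> by force
    define S where "S = 1 + (1 + \<bar>\<tau> 1\<bar>) / b"
    have "S \<ge> 1" unfolding S_def using \<open>b > 0\<close> by simp
    have "\<tau> 1 - b * 1 \<le> \<tau> S - b * S"
    proof (rule nondecreasing_of_deriv_within[OF \<open>S \<ge> 1\<close>])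
      fix t assume t: "t \<in> {1..S}"
      have "(\<tau> has_real_derivative (G * a - f t * \<tau> t) / lam) (at t within {1..S})"
        using d\<tau>[of t] t by (auto intro: DERIV_subset)
      then show "((\<lambda>t. \<tau> t - b * t) has_real_derivative (G * a - f t * \<tau> t) / lam - b)
                   (at t within {1..S})"
        by (auto intro!: derivative_eq_intros)
      have "f t * \<tau> t \<le> 0"
        using f_pos[of t] nonpos[of t] t by (simp add: mult_nonneg_nonpos)
      then show "(G * a - f t * \<tau> t) / lam - b \<ge> 0"
        unfolding b_def using \<open>lam > 0\<close> by (simp add: field_simps)
    qed
    moreover have "b * S = b + 1 + \<bar>\<tau> 1\<bar>"
      unfolding S_def using \<open>b > 0\<close> by (simp add: field_simps)
    ultimately have "\<tau> S > 0" by linarith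
    with nonpos[of S] \<open>S \<ge> 1\<close> show False by simp
  qed
  have "\<tau> t > 0" if "t \<ge> S" for t
  proof (rule positive_of_linear_differential_inequality[OF _ _ _ _ that])
    show "continuous_on {S..} (\<lambda>t. - f t / lam)"
      using ode_solution_continuous(2)[OF assms(1,5)] \<open>S > 0\<close> \<open>lam > 0\<close>
      by (auto intro!: continuous_intros intro: continuous_on_subset)
    show "(\<tau> has_real_derivative (G * a - f s * \<tau> s) / lam) (at s within {S..})" if "s \<ge> S" for s
      using d\<tau>[of s] that \<open>S > 0\<close> by (auto intro: DERIV_subset)
    show "- f s / lam * \<tau> s \<le> (G * a - f s * \<tau> s) / lam" for s
      using assms(1-3) by (simp add: field_simps)
    show "\<tau> S > 0" by fact
  qed
  with \<open>S > 0\<close> show thesis using that by blast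
qed

lemma steady_state:
  assumes "G > 0" and "\<xi> > 0" and "\<nu> > 0" and "a > 0"
  shows "f_inf G \<xi> \<nu> a > 0"
    and "f_inf G \<xi> \<nu> a + \<nu> * (f_inf G \<xi> \<nu> a)^2 = \<xi> * G * a"
    and "\<xi> * tau_inf G \<xi> \<nu> a = 1 + \<nu> * f_inf G \<xi> \<nu> a"
proof -
  define r where "r = sqrt (1 + 4 * \<nu> * \<xi> * G * a)"
  have "4 * \<nu> * \<xi> * G * a > 0" using assms by simp
  then have r: "r > 1" "r^2 = 1 + 4 * \<nu> * \<xi> * G * a"
    unfolding r_def by auto
  have f: "f_inf G \<xi> \<nu> a = (r - 1) / (2 * \<nu>)" unfolding f_inf_def r_def by simp
  show "f_inf G \<xi> \<nu> a > 0" unfolding f using r assms by simp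
  have "(r - 1) / (2 * \<nu>) + \<nu> * ((r - 1) / (2 * \<nu>))^2 = (r^2 - 1) / (4 * \<nu>)"
    using assms by (simp add: field_simps power2_eq_square)
  then show "f_inf G \<xi> \<nu> a + \<nu> * (f_inf G \<xi> \<nu> a)^2 = \<xi> * G * a"
    unfolding f r using assms by simp
  show "\<xi> * tau_inf G \<xi> \<nu> a = 1 + \<nu> * f_inf G \<xi> \<nu> a"
    unfolding f unfolding tau_inf_def r_def[symmetric] using assms by (simp add: field_simps)
qed

text \<open>
  For \<open>\<tau> > 0\<close> the absolute value disappears and the equation for \<open>f\<close> reads \<open>f' = f^2 * w\<close>.
  Substituting \<open>\<xi> * \<tau> = w + 1 + \<nu> * f\<close> into the equation for \<open>\<tau>\<close> gives the one for \<open>w\<close>.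
\<close>
lemma reduction_to_damped_oscillator:
  assumes "lam > 0" and "G > 0" and "\<xi> > 0" and "\<nu> > 0" and "a > 0" and "f0 > 0"
    and "ode_solution lam G \<xi> \<nu> a \<tau>0 f0 \<tau> f"
  obtains T where "T > 0"
    and "damped_oscillator (1 / lam) \<nu> (\<xi> * G * a) (f_inf G \<xi> \<nu> a) T f
           (\<lambda>t. \<xi> * \<tau> t - 1 - \<nu> * f t)"
proof -
  obtain T where "T > 0" and \<tau>_pos: "\<And>t. t \<ge> T \<Longrightarrow> \<tau> t > 0"
    using stress_eventually_positive assms by metis
  have interior: "at t within {0..} = at t" if "t \<ge> T" for t
    using that \<open>T > 0\<close> by (intro at_within_interior) simp
  have d\<tau>: "(\<tau> has_real_derivative (G * a - f t * \<tau> t) / lam) (at t)" if "t \<ge> T" for t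
    using ode_solution_deriv(1)[OF assms(1,7), of t] interior[OF that] that \<open>T > 0\<close> by simp
  have df: "(f has_real_derivative (f t)^2 * (\<xi> * \<tau> t - 1 - \<nu> * f t)) (at t)"
    if "t \<ge> T" for t
  proof -
    have "(f has_real_derivative (-1 + \<xi> * \<bar>\<tau> t\<bar>) * (f t)^2 - \<nu> * (f t)^3) (at t)"
      using ode_solution_deriv(2)[OF assms(1,7), of t] interior[OF that] that \<open>T > 0\<close> by simp
    moreover have "(-1 + \<xi> * \<bar>\<tau> t\<bar>) * (f t)^2 - \<nu> * (f t)^3
                     = (f t)^2 * (\<xi> * \<tau> t - 1 - \<nu> * f t)"
      using \<tau>_pos[OF that] by (simp add: algebra_simps power2_eq_square power3_eq_cube)
    ultimately show ?thesis by simp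
  qed
  have "damped_oscillator (1 / lam) \<nu> (\<xi> * G * a) (f_inf G \<xi> \<nu> a) T f
          (\<lambda>t. \<xi> * \<tau> t - 1 - \<nu> * f t)"
  proof
    show "1 / lam > 0" "\<nu> > 0" "f_inf G \<xi> \<nu> a > 0" "T \<ge> 0"
      "f_inf G \<xi> \<nu> a + \<nu> * (f_inf G \<xi> \<nu> a)^2 = \<xi> * G * a"
      using assms steady_state \<open>T > 0\<close> by simp_all
    fix t assume t: "t \<ge> T"
    show "f t > 0" using fluidity_positive[OF assms(1,6,7)] t \<open>T > 0\<close> by simp
    show "(f has_real_derivative (f t)^2 * (\<xi> * \<tau> t - 1 - \<nu> * f t)) (at t)" by (rule df[OF t])
    have "((\<lambda>t. \<xi> * \<tau> t - 1 - \<nu> * f t) has_real_derivative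
            \<xi> * ((G * a - f t * \<tau> t) / lam) - \<nu> * ((f t)^2 * (\<xi> * \<tau> t - 1 - \<nu> * f t))) (at t)"
      by (auto intro!: derivative_eq_intros d\<tau>[OF t] df[OF t])
    moreover have "\<xi> * ((G * a - f t * \<tau> t) / lam) - \<nu> * ((f t)^2 * (\<xi> * \<tau> t - 1 - \<nu> * f t))
        = - (1 / lam * f t + \<nu> * (f t)^2) * (\<xi> * \<tau> t - 1 - \<nu> * f t)
            - 1 / lam * (f t + \<nu> * (f t)^2 - \<xi> * G * a)"
      using \<open>lam > 0\<close> by (simp add: field_simps power2_eq_square)
    ultimately show "((\<lambda>t. \<xi> * \<tau> t - 1 - \<nu> * f t) has_real_derivative
        - (1 / lam * f t + \<nu> * (f t)^2) * (\<xi> * \<tau> t - 1 - \<nu> * f t)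
            - 1 / lam * (f t + \<nu> * (f t)^2 - \<xi> * G * a)) (at t)"
      by simp
  qed
  with \<open>T > 0\<close> show thesis using that by blast
qed

section \<open>Boundedness and long-time behaviour\<close>

theorem theorem4p2:
  fixes lam G \<xi> \<nu> a \<tau>0 f0 :: real and \<tau> f :: "real \<Rightarrow> real"
  assumes "lam > 0" and "G > 0" and "\<xi> > 0" and "\<nu> > 0" and "a > 0" and "f0 > 0"
    and "ode_solution lam G \<xi> \<nu> a \<tau>0 f0 \<tau> f"
  shows "bounded ((\<lambda>t. (\<tau> t, f t)) ` {0..}) \<and>
    (- 1 / lam - 2 + 2 * \<xi> * (1 + G * a) *
           (1 / sigma G \<xi> \<nu> a
            + lam * \<xi> / (2 * G * a) * ((\<nu> * sigma G \<xi> \<nu> a + 1) / \<xi> + 4 / \<xi>)^2) < 0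
         \<longrightarrow> (\<tau> \<longlongrightarrow> tau_inf G \<xi> \<nu> a) at_top
           \<and> (f \<longlongrightarrow> f_inf G \<xi> \<nu> a) at_top
           \<and> (Delta lam G \<xi> \<nu> a \<noteq> 0 \<longrightarrow>
                (\<exists>C0. \<forall>\<^sub>F t in at_top.
                   \<bar>\<tau> t - tau_inf G \<xi> \<nu> a\<bar> + \<bar>f t - f_inf G \<xi> \<nu> a\<bar>
                     \<le> C0 * exp (- conv_rate lam G \<xi> \<nu> a * t)))
           \<and> (Delta lam G \<xi> \<nu> a = 0 \<longrightarrow>
                (\<exists>C0. \<forall>\<^sub>F t in at_top.
                   \<bar>\<tau> t - tau_inf G \<xi> \<nu> a\<bar> + \<bar>f t - f_inf G \<xi> \<nu> a\<bar>
                     \<le> C0 * (1 + t) * exp (- conv_rate lam G \<xi> \<nu> a * t))))"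
proof -
  define F where "F = f_inf G \<xi> \<nu> a"
  define \<tau>F where "\<tau>F = tau_inf G \<xi> \<nu> a"
  define w where "w = (\<lambda>t. \<xi> * \<tau> t - 1 - \<nu> * f t)"
  obtain T where "T > 0" and osc: "damped_oscillator (1 / lam) \<nu> (\<xi> * G * a) F T f w"
    using reduction_to_damped_oscillator[OF assms] unfolding F_def w_def by blast
  interpret damped_oscillator "1 / lam" \<nu> "\<xi> * G * a" F T f w by (rule osc)
  note ss = steady_state[OF assms(2-5), folded F_def \<tau>F_def]
  have \<tau>_eq: "\<tau> t = (w t + 1 + \<nu> * f t) / \<xi>" for t
    unfolding w_def using \<open>\<xi> > 0\<close> by simp
  have \<tau>F_eq: "\<tau>F = (1 + \<nu> * F) / \<xi>"
    using ss(3) \<open>\<xi> > 0\<close> by (simp add: field_simps)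
  note cont = ode_solution_continuous[OF assms(1,7)]

  have "bounded ((\<lambda>t. (\<tau> t, f t)) ` {0..})"
  proof -
    have "compact ((\<lambda>t. (\<tau> t, f t)) ` {0..T})"
      using cont by (intro compact_continuous_image continuous_on_Pair)
        (auto intro: continuous_on_subset)
    then have early: "bounded ((\<lambda>t. (\<tau> t, f t)) ` {0..T})" by (rule compact_imp_bounded)
    obtain m M where m: "0 < m" "m \<le> F" "F \<le> M"
      and orbit: "\<And>t. t \<ge> T \<Longrightarrow> m \<le> f t \<and> f t \<le> M \<and> \<bar>w t\<bar> \<le> M"
      using orbit_bounds by blast
    have "norm (\<tau> t, f t) \<le> (M + 1 + \<nu> * M) / \<xi> + M" if "t \<ge> T" for t
    proof -
      have o: "0 < f t" "f t \<le> M" "\<bar>w t\<bar> \<le> M" using orbit[OF that] m by auto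
      have "\<bar>w t + 1 + \<nu> * f t\<bar> \<le> M + 1 + \<nu> * M"
      proof -
        have "0 \<le> \<nu> * f t" "\<nu> * f t \<le> \<nu> * M" using o \<open>\<nu> > 0\<close> by simp_all
        then show ?thesis using o(3) by linarith
      qed
      then have "\<bar>\<tau> t\<bar> \<le> (M + 1 + \<nu> * M) / \<xi>"
        unfolding \<tau>_eq using \<open>\<xi> > 0\<close> by (simp add: divide_right_mono)
      moreover have "norm (\<tau> t, f t) \<le> \<bar>\<tau> t\<bar> + \<bar>f t\<bar>"
        using norm_Pair_le[of "\<tau> t" "f t"] by simp
      ultimately show ?thesis using o by linarith
    qed
    then have late: "bounded ((\<lambda>t. (\<tau> t, f t)) ` {T..})"
      unfolding bounded_iff by blast
    have "{0..} = {0..T} \<union> {T..}" using \<open>T > 0\<close> by auto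
    then show ?thesis using early late by (simp add: image_Un)
  qed
  moreover have "(\<tau> \<longlongrightarrow> \<tau>F) at_top"
  proof -
    have "((\<lambda>t. (w t + 1 + \<nu> * f t) / \<xi>) \<longlongrightarrow> (0 + 1 + \<nu> * F) / \<xi>) at_top"
      using \<open>\<xi> > 0\<close> by (intro tendsto_intros tendsto_equilibrium) simp
    moreover have "(\<lambda>t. (w t + 1 + \<nu> * f t) / \<xi>) = \<tau>" using \<tau>_eq by auto
    ultimately show ?thesis unfolding \<tau>F_eq by simp
  qed
  moreover define c where "c = 1 + (1 + \<nu>) / \<xi>"
  have "c > 0" unfolding c_def using \<open>\<xi> > 0\<close> \<open>\<nu> > 0\<close> by (simp add: add_pos_pos)
  have transfer: "\<bar>\<tau> t - \<tau>F\<bar> + \<bar>f t - F\<bar> \<le> c * b" if "\<bar>f t - F\<bar> + \<bar>w t\<bar> \<le> b" for t b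
  proof -
    have "\<bar>\<tau> t - \<tau>F\<bar> = \<bar>w t + \<nu> * (f t - F)\<bar> / \<xi>"
      unfolding \<tau>_eq \<tau>F_eq using \<open>\<xi> > 0\<close> by (simp add: algebra_simps flip: diff_divide_distrib)
    also have "\<dots> \<le> ((1 + \<nu>) * (\<bar>f t - F\<bar> + \<bar>w t\<bar>)) / \<xi>"
    proof (intro divide_right_mono)
      have "\<bar>w t + \<nu> * (f t - F)\<bar> \<le> \<bar>w t\<bar> + \<nu> * \<bar>f t - F\<bar>"
        using abs_triangle_ineq[of "w t" "\<nu> * (f t - F)"] \<open>\<nu> > 0\<close> by (simp add: abs_mult)
      moreover have "\<nu> * \<bar>w t\<bar> \<ge> 0" using \<open>\<nu> > 0\<close> by simp
      ultimately show "\<bar>w t + \<nu> * (f t - F)\<bar> \<le> (1 + \<nu>) * (\<bar>f t - F\<bar> + \<bar>w t\<bar>)"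
        by (simp add: algebra_simps)
    qed (use \<open>\<xi> > 0\<close> in simp)
    finally have "\<bar>\<tau> t - \<tau>F\<bar> + \<bar>f t - F\<bar> \<le> (\<bar>f t - F\<bar> + \<bar>w t\<bar>)
                    + ((1 + \<nu>) * (\<bar>f t - F\<bar> + \<bar>w t\<bar>)) / \<xi>"
      by linarith
    also have "\<dots> = c * (\<bar>f t - F\<bar> + \<bar>w t\<bar>)"
      unfolding c_def by (simp add: distrib_right)
    also have "\<dots> \<le> c * b" using that \<open>c > 0\<close> by simp
    finally show ?thesis .
  qed
  have Delta: "Delta lam G \<xi> \<nu> a = 4 * discriminant"
  proof -
    have "\<xi> / lam * \<tau>F = (1 + \<nu> * F) / lam" using ss(3) by simp
    then show ?thesis
      unfolding Delta_def discriminant_def damping_def F_def[symmetric] \<tau>F_def[symmetric]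
      using \<open>lam > 0\<close> by (simp add: field_simps power2_eq_square)
  qed
  have rate: "conv_rate lam G \<xi> \<nu> a = damping - sqrt (max discriminant 0)"
  proof -
    have "sqrt (4 * discriminant) = 2 * sqrt discriminant" by (simp add: real_sqrt_mult)
    then show ?thesis
      unfolding conv_rate_def Delta F_def[symmetric] damping_def by (simp add: max_def)
  qed
  have "\<exists>C0. \<forall>\<^sub>F t in at_top. \<bar>\<tau> t - \<tau>F\<bar> + \<bar>f t - F\<bar> \<le> C0 * exp (- conv_rate lam G \<xi> \<nu> a * t)"
    if "Delta lam G \<xi> \<nu> a \<noteq> 0"
  proof -
    have "discriminant \<noteq> 0" using that Delta by simp
    then obtain C where C: "\<forall>t\<ge>T. \<bar>f t - F\<bar> + \<bar>w t\<bar> \<le> C * exp (- conv_rate lam G \<xi> \<nu> a * t)"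
      using rate_of_convergence(1) unfolding rate by blast
    have "\<forall>\<^sub>F t in at_top. \<bar>\<tau> t - \<tau>F\<bar> + \<bar>f t - F\<bar>
            \<le> (c * C) * exp (- conv_rate lam G \<xi> \<nu> a * t)"
      unfolding mult.assoc using transfer C by (intro eventually_at_top_linorderI[of T]) blast
    then show ?thesis by blast
  qed
  moreover have "\<exists>C0. \<forall>\<^sub>F t in at_top. \<bar>\<tau> t - \<tau>F\<bar> + \<bar>f t - F\<bar>
                   \<le> C0 * (1 + t) * exp (- conv_rate lam G \<xi> \<nu> a * t)"
    if "Delta lam G \<xi> \<nu> a = 0"
  proof -
    have "discriminant = 0" using that Delta by simp
    then obtain C where C: "\<forall>t\<ge>T. \<bar>f t - F\<bar> + \<bar>w t\<bar>
                              \<le> C * (1 + t) * exp (- conv_rate lam G \<xi> \<nu> a * t)"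
      using rate_of_convergence(2) unfolding rate by auto
    have "\<forall>\<^sub>F t in at_top. \<bar>\<tau> t - \<tau>F\<bar> + \<bar>f t - F\<bar>
            \<le> (c * C) * (1 + t) * exp (- conv_rate lam G \<xi> \<nu> a * t)"
      using transfer C unfolding mult.assoc by (intro eventually_at_top_linorderI[of T]) blast
    then show ?thesis by blast
  qed
  ultimately show ?thesis
    using tendsto_equilibrium(1) unfolding F_def \<tau>F_def by blast
qed

end
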